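(* There exists an Axiom A regular polynomial skew product $f(z,w)=(p(z),q(z,w))$ on $\mathbb{C}^2$ of degree four with the following properties: (a) $J_p$ is neither connected nor totally disconnected; (b) $A_{pt}(C_{J_p})=A_{cc}(C_{J_p})\neq A(C_{J_p})$.
   Context: A polynomial skew product of degree $d\ge2$ on $\mathbb{C}^2$ is a map $f(z,w)=(p(z),q(z,w))$ where $p(z)$ and $q_z(w):=q(z,w)$ are polynomials of degree $d$; it is regular if it extends to a holomorphic map of $\mathbb{P}^2$. It is Axiom A if its non-wandering set $\Omega$ is compact, periodic points are dense in $\Omega$ (hence $f(\Omega)=\Omega$), and $\Omega$ is hyperbolic, where hyperbolicity for the non-invertible map $f$ is understood through the natural extension $\hat\Omega=\{(x_k)_{k\le 0}: x_k\in\Omega,\ f(x_k)=x_{k+1}\}$ with its shift map. $J_p$ is the Julia set of $p$. $C_{J_p}=\{(z,w)\in J_p\times\mathbb{C}: q_z'(w)=0\}$. For $X\subset\mathbb{C}^2$, $A(X)=\bigcap_{N\ge 0}\overline{\bigcup_{n\ge N}f^n(X)}$ and $A(x)=A(\{x\})$. $A_{pt}(C_{J_p})=\overline{\bigcup_{x\in C_{J_p}}A(x)}$ and $A_{cc}(C_{J_p})=\overline{\bigcup_{C}A(C)}$, the latter union over all connected components $C$ of $C_{J_p}$. *)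

theory Defs
  imports "HOL-Analysis.Analysis" "HOL-Computational_Algebra.Polynomial"
begin

section \<open>Holomorphic maps of the complex projective plane\<close>

definition scaleC2 :: "complex \<Rightarrow> complex \<times> complex \<Rightarrow> complex \<times> complex" where
  "scaleC2 c v = (c * fst v, c * snd v)"

text \<open>Holomorphy in two variables: the (real) Frechet derivative exists and is complex-linear.
  As for \<^const>\<open>differentiable_on\<close>, this is meant for open sets.\<close>

definition holomorphic2_on :: "(complex \<times> complex \<Rightarrow> complex \<times> complex) \<Rightarrow> (complex \<times> complex) set \<Rightarrow> bool" where
  "holomorphic2_on F S \<longleftrightarrow>
     (\<forall>x\<in>S. \<exists>D. (F has_derivative D) (at x) \<and> (\<forall>c v. D (scaleC2 c v) = scaleC2 c (D v)))"

definition proj_rel :: "complex^3 \<Rightarrow> complex^3 \<Rightarrow> bool" where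
  "proj_rel x y \<longleftrightarrow> x \<noteq> 0 \<and> y \<noteq> 0 \<and> (\<exists>c. c \<noteq> 0 \<and> y = c *s x)"

lemma proj_rel_part_equivp: "part_equivp proj_rel"
proof (rule part_equivpI)
  have "proj_rel 1 1"
    unfolding proj_rel_def by (intro conjI exI[of _ 1]) (auto simp: vec_eq_iff)
  then show "\<exists>x. proj_rel x x" ..
  show "symp proj_rel"
  proof (rule sympI)
    fix x y assume "proj_rel x y"
    then obtain c where "x \<noteq> 0" "y \<noteq> 0" "c \<noteq> 0" "y = c *s x"
      by (auto simp: proj_rel_def)
    then show "proj_rel y x"
      unfolding proj_rel_def by (intro conjI exI[of _ "inverse c"]) (auto simp: vec_eq_iff)
  qed
  show "transp proj_rel"
  proof (rule transpI)
    fix x y z assume "proj_rel x y" "proj_rel y z"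
    then obtain c d where "x \<noteq> 0" "z \<noteq> 0" "c \<noteq> 0" "d \<noteq> 0" "y = c *s x" "z = d *s y"
      by (auto simp: proj_rel_def)
    then show "proj_rel x z"
      unfolding proj_rel_def by (intro conjI exI[of _ "d * c"]) (auto simp: vec_eq_iff)
  qed
qed

quotient_type proj_plane = "complex^3" / partial: proj_rel
  by (rule proj_rel_part_equivp)

text \<open>Homogeneous coordinates are indexed cyclically by the type \<^typ>\<open>3\<close>. The chart with index
  \<open>i\<close> is defined where the coordinate \<open>i\<close> is nonzero; it divides the coordinates \<open>i + 1\<close> and
  \<open>i + 2\<close> by the coordinate \<open>i\<close>. The point \<open>affine_point i\<close> is the inverse of the chart; in
  particular \<open>affine_point 3 (z, w) = [z : w : 1]\<close>.\<close>

definition affine_domain :: "3 \<Rightarrow> proj_plane set" where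
  "affine_domain i = {P. rep_proj_plane P $ i \<noteq> 0}"

definition affine_chart :: "3 \<Rightarrow> proj_plane \<Rightarrow> complex \<times> complex" where
  "affine_chart i P =
     (rep_proj_plane P $ (i + 1) / rep_proj_plane P $ i,
      rep_proj_plane P $ (i + 2) / rep_proj_plane P $ i)"

definition affine_point :: "3 \<Rightarrow> complex \<times> complex \<Rightarrow> proj_plane" where
  "affine_point i a =
     abs_proj_plane (\<chi> k. if k = i then 1 else if k = i + 1 then fst a else snd a)"

text \<open>A map of the plane is holomorphic if it is so in all charts. Openness of the sets on which
  the coordinate expressions are defined, together with their continuity, expresses continuity
  of the map.\<close>

definition holomorphic_self_map :: "(proj_plane \<Rightarrow> proj_plane) \<Rightarrow> bool" where
  "holomorphic_self_map G \<longleftrightarrow>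
     (\<forall>i j. open {a. G (affine_point i a) \<in> affine_domain j} \<and>
            holomorphic2_on (\<lambda>a. affine_chart j (G (affine_point i a)))
              {a. G (affine_point i a) \<in> affine_domain j})"


section \<open>Polynomial skew products\<close>

text \<open>The polynomial \<open>q(z, w)\<close> is represented as a polynomial in \<open>w\<close> whose coefficients are
  polynomials in \<open>z\<close>.\<close>

definition fiber_poly :: "complex poly poly \<Rightarrow> complex \<Rightarrow> complex poly" where
  "fiber_poly q z = map_poly (\<lambda>c. poly c z) q"

definition skew_map :: "complex poly \<Rightarrow> complex poly poly \<Rightarrow> complex \<times> complex \<Rightarrow> complex \<times> complex" where
  "skew_map p q = (\<lambda>(z, w). (poly p z, poly (fiber_poly q z) w))"

definition polynomial_skew_product :: "nat \<Rightarrow> complex poly \<Rightarrow> complex poly poly \<Rightarrow> bool" where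
  "polynomial_skew_product d p q \<longleftrightarrow>
     d \<ge> 2 \<and> degree p = d \<and> (\<forall>z. degree (fiber_poly q z) = d)"

definition regular_map :: "(complex \<times> complex \<Rightarrow> complex \<times> complex) \<Rightarrow> bool" where
  "regular_map f \<longleftrightarrow>
     (\<exists>G. holomorphic_self_map G \<and> (\<forall>x. G (affine_point 3 x) = affine_point 3 (f x)))"


section \<open>Axiom A\<close>

definition nonwandering :: "('a::topological_space \<Rightarrow> 'a) \<Rightarrow> 'a set" where
  "nonwandering f = {x. \<forall>U. open U \<longrightarrow> x \<in> U \<longrightarrow> (\<exists>n\<ge>1. (f ^^ n) ` U \<inter> U \<noteq> {})}"

definition periodic_points :: "('a \<Rightarrow> 'a) \<Rightarrow> 'a set" where
  "periodic_points f = {x. \<exists>n\<ge>1. (f ^^ n) x = x}"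

text \<open>A history \<open>(x\<^sub>k)\<close>, \<open>k \<le> 0\<close>, is represented by \<open>h :: nat \<Rightarrow> 'a\<close> with \<open>h n = x\<^sub>-\<^sub>n\<close>.
  The topology on histories is the product topology.\<close>

definition natural_extension :: "('a \<Rightarrow> 'a) \<Rightarrow> 'a set \<Rightarrow> (nat \<Rightarrow> 'a) set" where
  "natural_extension f L = {h. (\<forall>n. h n \<in> L) \<and> (\<forall>n. f (h (Suc n)) = h n)}"

definition history_shift :: "('a \<Rightarrow> 'a) \<Rightarrow> (nat \<Rightarrow> 'a) \<Rightarrow> nat \<Rightarrow> 'a" where
  "history_shift f h = case_nat (f (h 0)) h"

definition csubspace2 :: "(complex \<times> complex) set \<Rightarrow> bool" where
  "csubspace2 V \<longleftrightarrow> subspace V \<and> (\<forall>c. \<forall>v\<in>V. scaleC2 c v \<in> V)"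

text \<open>The fibre over a history \<open>h\<close> of the tangent bundle of the natural extension is the tangent
  space at \<open>h 0\<close>. A splitting into complex subspaces is continuous if the projection onto one
  summand along the other is continuous on the bundle.\<close>

definition continuous_splitting ::
  "(nat \<Rightarrow> complex \<times> complex) set \<Rightarrow> ((nat \<Rightarrow> complex \<times> complex) \<Rightarrow> (complex \<times> complex) set) \<Rightarrow>
   ((nat \<Rightarrow> complex \<times> complex) \<Rightarrow> (complex \<times> complex) set) \<Rightarrow> bool" where
  "continuous_splitting H Es Eu \<longleftrightarrow>
     (\<forall>h\<in>H. csubspace2 (Es h) \<and> csubspace2 (Eu h) \<and>
            (\<forall>v. \<exists>!a. a \<in> Es h \<and> v - a \<in> Eu h)) \<and>
     continuous_on (H \<times> UNIV) (\<lambda>(h, v). THE a. a \<in> Es h \<and> v - a \<in> Eu h)"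

definition hyperbolic_on :: "(complex \<times> complex \<Rightarrow> complex \<times> complex) \<Rightarrow> (complex \<times> complex) set \<Rightarrow> bool" where
  "hyperbolic_on f L \<longleftrightarrow>
     (\<exists>Es Eu. continuous_splitting (natural_extension f L) Es Eu \<and>
        (\<forall>h\<in>natural_extension f L.
           frechet_derivative f (at (h 0)) ` Es h \<subseteq> Es (history_shift f h) \<and>
           frechet_derivative f (at (h 0)) ` Eu h = Eu (history_shift f h)) \<and>
        (\<exists>C>0. \<exists>r>1. \<forall>h\<in>natural_extension f L. \<forall>n\<ge>1.
           (\<forall>v\<in>Es h. norm (frechet_derivative (f ^^ n) (at (h 0)) v) \<le> C / r ^ n * norm v) \<and>
           (\<forall>v\<in>Eu h. norm (frechet_derivative (f ^^ n) (at (h 0)) v) \<ge> r ^ n / C * norm v)))"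

definition axiom_A :: "(complex \<times> complex \<Rightarrow> complex \<times> complex) \<Rightarrow> bool" where
  "axiom_A f \<longleftrightarrow>
     compact (nonwandering f) \<and>
     nonwandering f \<subseteq> closure (periodic_points f) \<and>
     hyperbolic_on f (nonwandering f)"


section \<open>Julia sets and accumulation sets\<close>

definition filled_julia :: "complex poly \<Rightarrow> complex set" where
  "filled_julia p = {z. bounded (range (\<lambda>n. (poly p ^^ n) z))}"

definition julia :: "complex poly \<Rightarrow> complex set" where
  "julia p = frontier (filled_julia p)"

definition totally_disconnected :: "'a::topological_space set \<Rightarrow> bool" where
  "totally_disconnected S \<longleftrightarrow> (\<forall>T\<subseteq>S. connected T \<longrightarrow> (\<exists>a. T \<subseteq> {a}))"

definition crit_set :: "complex poly \<Rightarrow> complex poly poly \<Rightarrow> (complex \<times> complex) set" where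
  "crit_set p q = {(z, w). z \<in> julia p \<and> poly (pderiv (fiber_poly q z)) w = 0}"

definition acc_set :: "('a::topological_space \<Rightarrow> 'a) \<Rightarrow> 'a set \<Rightarrow> 'a set" where
  "acc_set f X = (\<Inter>N. closure (\<Union>n\<in>{N..}. (f ^^ n) ` X))"

definition acc_pt :: "('a::topological_space \<Rightarrow> 'a) \<Rightarrow> 'a set \<Rightarrow> 'a set" where
  "acc_pt f X = closure (\<Union>x\<in>X. acc_set f {x})"

definition acc_cc :: "('a::topological_space \<Rightarrow> 'a) \<Rightarrow> 'a set \<Rightarrow> 'a set" where
  "acc_cc f X = closure (\<Union>C\<in>components X. acc_set f C)"

end

theory Submission
  imports Defs
begin

text \<open>The example is \<open>p(z) = z\<^sup>3 (1001 - 1000 z)\<close> and \<open>q(z, w) = w\<^sup>4 + 4 z\<^sup>2 - 4\<close>. The filled Julia set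
  of \<open>p\<close> lies in the union of a small disc around the superattracting fixed point \<open>0\<close>, which
  contributes nontrivial components, and a tiny disc \<open>D\<close> around the repelling fixed point \<open>1\<close>, on
  which \<open>p\<close> is injective; hence \<open>{1}\<close> is a component of the Julia set. Near \<open>z = 1\<close> the fibre maps
  are close to \<open>w\<^sup>4\<close> and attract \<open>w = 0\<close>; near \<open>z = 0\<close> they are close to \<open>w\<^sup>4 - 4\<close>, whose critical
  orbit escapes. A critical point \<open>(z, 0)\<close> over the Julia set therefore escapes unless the orbit of
  \<open>z\<close> stays in \<open>D\<close>, that is unless \<open>z = 1\<close>, and the escape is uniform on components. So the
  pointwise and the componentwise accumulation sets are the saddle fixed point \<open>(1, 0)\<close> alone. But
  critical points \<open>(z, 0)\<close> with \<open>z\<close> close to \<open>1\<close> follow the unstable manifold of the saddle for a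
  while, so the accumulation set of the whole critical set is larger.

  Apart from the saddle, the nonwandering set consists of points with \<open>z = 0\<close>, where
  \<open>w\<^sup>4 - 4\<close> is expanding, and points near which the skew product expands every direction; periodic
  points are dense there by shadowing.\<close>

section \<open>The base and fibre maps\<close>

definition base_map :: "complex \<Rightarrow> complex" where
  "base_map z = z ^ 3 * (1001 - 1000 * z)"

definition skew :: "complex \<times> complex \<Rightarrow> complex \<times> complex" where
  "skew x = (base_map (fst x), snd x ^ 4 + (4 * (fst x)\<^sup>2 - 4))"

section \<open>Escape, splitting and fixed point estimates for the base map\<close>

lemma norm_base_map: "norm (base_map z) = norm z ^ 3 * norm (1001 - 1000 * z)"
  by (simp add: base_map_def norm_mult norm_power)

text \<open>From this radius on, \<open>1000 * z\<close> exceeds 1001 in modulus by at least 9, and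
  that factor alone beats 2.\<close>

lemma base_map_escape:
  assumes "norm z \<ge> 101/100"
  shows "norm (base_map z) \<ge> 2 * norm z"
proof -
  have "norm (1000 * z) - norm (1001::complex) \<le> norm (1000 * z - 1001)"
    by (rule norm_triangle_ineq2)
  then have "norm (1001 - 1000 * z) \<ge> 9"
    using assms by (simp add: norm_mult norm_minus_commute)
  moreover have "norm z ^ 3 \<ge> norm z * 1"
    unfolding power3_eq_cube mult.assoc using assms
    by (intro mult_left_mono) (auto intro!: mult_ge1_I)
  ultimately have "norm z ^ 3 * norm (1001 - 1000 * z) \<ge> (norm z * 1) * 9"
    by (intro mult_mono) auto
  then show ?thesis
    using assms by (simp add: norm_base_map)
qed

text \<open>This is what disconnects the Julia set. For \<open>norm z <= 1/2\<close> the linear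
  factor is at least 501, so the cube must be tiny; otherwise the cube is at least 1/8, so the
  linear factor must be small, which puts \<open>z\<close> near 1.\<close>

lemma base_map_bounded_cases:
  assumes "norm (base_map z) \<le> 101/100"
  shows "norm z \<le> 13/100 \<or> norm (z - 1) \<le> 1/100"
proof (cases "norm z \<le> 1/2")
  case True
  have "norm (1001::complex) - norm (1000 * z) \<le> norm (1001 - 1000 * z)"
    by (rule norm_triangle_ineq2)
  then have ge: "norm (1001 - 1000 * z) \<ge> 501"
    using True by (simp add: norm_mult)
  have "norm z ^ 3 * 501 \<le> norm z ^ 3 * norm (1001 - 1000 * z)"
    using ge by (intro mult_left_mono) auto
  then have le: "norm z ^ 3 * 501 \<le> 101/100"
    using assms by (simp add: norm_base_map)
  have "norm z \<le> 13/100"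
  proof (rule ccontr)
    assume "\<not> norm z \<le> 13/100"
    then have "norm z ^ 3 \<ge> (13/100) ^ 3"
      by (intro power_mono) auto
    then show False
      using le by (simp add: power3_eq_cube)
  qed
  then show ?thesis ..
next
  case False
  then have "norm z ^ 3 \<ge> (1/2) ^ 3"
    by (intro power_mono) auto
  then have "(1/8) * norm (1001 - 1000 * z) \<le> norm z ^ 3 * norm (1001 - 1000 * z)"
    by (intro mult_right_mono) (auto simp: power3_eq_cube)
  then have "norm (1001 - 1000 * z) \<le> 808/100"
    using assms by (simp add: norm_base_map)
  moreover have "norm (1000 * (z - 1)) \<le> norm (1::complex) + norm (1001 - 1000 * z)"
    using norm_triangle_ineq4[of 1 "1001 - 1000 * z"] by (simp add: algebra_simps)
  moreover have "norm (1000 * (z - 1)) = 1000 * norm (z - 1)"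
    by (simp only: norm_mult) simp
  ultimately have "norm (z - 1) \<le> 1/100"
    by simp
  then show ?thesis ..
qed

lemma base_map_1 [simp]: "base_map 1 = 1"
  and base_map_0 [simp]: "base_map 0 = 0"
  by (simp_all add: base_map_def)

lemma norm_near_1:
  fixes z :: complex
  assumes "norm (z - 1) \<le> e"
  shows "1 - e \<le> norm z" "norm z \<le> 1 + e"
  using assms norm_triangle_ineq3[of z 1] by auto

text \<open>Up to sign, \<open>base_map z - 1\<close> is \<open>z - 1\<close> times a cofactor
  dominated by \<open>1000 * z ^ 3\<close>.\<close>

lemma base_map_expands_at_1:
  assumes "norm (z - 1) \<le> 1/100"
  shows "norm (base_map z - 1) \<ge> 2 * norm (z - 1)"
proof -
  have b: "(99/100) \<le> norm z" "norm z \<le> 101/100"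
    using norm_near_1[OF assms] by auto
  have "norm (z\<^sup>2 + z + 1) \<le> norm z ^ 2 + norm z + 1"
    by (intro norm_triangle_le add_mono) (auto simp: norm_power)
  also have "\<dots> \<le> (101/100) ^ 2 + (101/100) + 1"
    using b by (intro add_mono power_mono) auto
  finally have "norm (z\<^sup>2 + z + 1) \<le> 4"
    by (simp add: power2_eq_square)
  moreover have "norm (1000 * z ^ 3) \<ge> 1000 * (99/100) ^ 3"
    using b by (auto simp: norm_mult norm_power intro!: power_mono)
  moreover have "norm (1000 * z ^ 3) - norm (z\<^sup>2 + z + 1) \<le> norm (1000 * z ^ 3 - (z\<^sup>2 + z + 1))"
    by (rule norm_triangle_ineq2)
  ultimately have "norm (1000 * z ^ 3 - (z\<^sup>2 + z + 1)) \<ge> 2"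
    by (simp add: power3_eq_cube)
  from mult_left_mono[OF this norm_ge_zero[of "z - 1"]]
  have "2 * norm (z - 1) \<le> norm (- ((z - 1) * (1000 * z ^ 3 - (z\<^sup>2 + z + 1))))"
    by (simp only: norm_mult norm_minus_cancel mult.commute)
  also have "- ((z - 1) * (1000 * z ^ 3 - (z\<^sup>2 + z + 1))) = base_map z - 1"
    by (simp add: base_map_def algebra_simps power2_eq_square power3_eq_cube)
  finally show ?thesis .
qed

text \<open>The radius is tuned against \<open>base_deriv_near_0\<close>: contraction holds up to
  29/1000 and the derivative expands from 28/1000 on, so the two regimes overlap.\<close>

lemma base_map_contracts_at_0:
  assumes "norm z \<le> 29/1000"
  shows "norm (base_map z) \<le> (87/100) * norm z"
proof -
  have "norm (1001 - 1000 * z) \<le> norm (1001::complex) + norm (1000 * z)"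
    by (rule norm_triangle_ineq4)
  then have "norm (1001 - 1000 * z) \<le> 1030"
    using assms by (simp add: norm_mult)
  moreover have "norm z ^ 2 \<le> (29/1000) ^ 2"
    using assms by (intro power_mono) auto
  ultimately have "norm z ^ 2 * norm (1001 - 1000 * z) \<le> (29/1000) ^ 2 * 1030"
    by (intro mult_mono) auto
  then have "norm z ^ 2 * norm (1001 - 1000 * z) \<le> 87/100"
    by (simp add: power2_eq_square)
  from mult_left_mono[OF this norm_ge_zero[of z]] show ?thesis
    by (simp add: norm_base_map power3_eq_cube power2_eq_square mult.commute mult.assoc)
qed

section \<open>Estimates for the fibre maps\<close>

lemma offset_near_1:
  fixes z :: complex
  assumes "norm (z - 1) \<le> e" "e \<le> 1"
  shows "norm (4 * z\<^sup>2 - 4) \<le> 12 * e"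
proof -
  have "norm (z + 1) \<le> norm (z - 1) + norm (2::complex)"
    using norm_triangle_ineq[of "z - 1" 2] by (simp add: add.commute)
  then have "norm (z - 1) * norm (z + 1) \<le> e * 3"
    using assms by (intro mult_mono) (auto intro: order_trans[OF norm_ge_zero])
  moreover have "4 * z\<^sup>2 - 4 = 4 * ((z - 1) * (z + 1))"
    by (simp add: algebra_simps power2_eq_square)
  ultimately show ?thesis
    by (simp add: norm_mult)
qed

lemma offset_near_0:
  fixes z :: complex
  assumes "norm z \<le> 13/100"
  shows "norm (4 * z\<^sup>2 - 4) \<ge> 39/10"
proof -
  have "norm z ^ 2 \<le> (13/100) ^ 2"
    using assms by (intro power_mono) auto
  moreover have "norm (4::complex) - norm (4 * z\<^sup>2) \<le> norm (4 - 4 * z\<^sup>2)"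
    by (rule norm_triangle_ineq2)
  ultimately show ?thesis
    by (simp add: norm_mult norm_power norm_minus_commute power2_eq_square)
qed

lemma offset_bounded:
  fixes z :: complex
  assumes "norm z \<le> 101/100"
  shows "norm (4 * z\<^sup>2 - 4) \<le> 9"
proof -
  have "norm z ^ 2 \<le> (101/100) ^ 2"
    using assms by (intro power_mono) auto
  moreover have "norm (4 * z\<^sup>2 - 4) \<le> norm (4 * z\<^sup>2) + norm (4::complex)"
    by (rule norm_triangle_ineq4)
  ultimately show ?thesis
    by (simp add: norm_mult norm_power power2_eq_square)
qed

lemma fst_skew [simp]: "fst (skew x) = base_map (fst x)"
  by (simp add: skew_def)

lemma norm_snd_skew_ge:
  "norm (snd x) ^ 4 - norm (4 * (fst x)\<^sup>2 - 4) \<le> norm (snd (skew x))"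
  "norm (4 * (fst x)\<^sup>2 - 4) - norm (snd x) ^ 4 \<le> norm (snd (skew x))"
  using norm_diff_ineq[of "snd x ^ 4" "4 * (fst x)\<^sup>2 - 4"]
    norm_diff_ineq[of "4 * (fst x)\<^sup>2 - 4" "snd x ^ 4"]
  by (simp_all add: skew_def norm_power add.commute)

lemma norm_snd_skew_le:
  "norm (snd (skew x)) \<le> norm (snd x) ^ 4 + norm (4 * (fst x)\<^sup>2 - 4)"
  using norm_triangle_ineq[of "snd x ^ 4" "4 * (fst x)\<^sup>2 - 4"]
  by (simp add: skew_def norm_power)

text \<open>The quartic term is at least \<open>8 * norm (snd x)\<close>, and taking away an offset
  of modulus at most 9 still leaves twice the norm.\<close>

lemma skew_escape:
  assumes "norm (fst x) \<le> 101/100" "norm (snd x) \<ge> 2"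
  shows "norm (snd (skew x)) \<ge> 2 * norm (snd x)" "norm (snd (skew x)) > 2"
proof -
  have "norm (snd x) ^ 3 \<ge> 2 ^ 3"
    using assms by (intro power_mono) auto
  then have "norm (snd x) * 8 \<le> norm (snd x) * norm (snd x) ^ 3"
    by (intro mult_left_mono) auto
  then have "norm (snd x) ^ 4 \<ge> 8 * norm (snd x)"
    by (simp add: eval_nat_numeral)
  then show "norm (snd (skew x)) \<ge> 2 * norm (snd x)" "norm (snd (skew x)) > 2"
    using offset_bounded[OF assms(1)] norm_snd_skew_ge(1)[of x] assms(2) by linarith+
qed

lemma pow4_le:
  fixes t :: real
  assumes "0 \<le> t" "t \<le> 9/10"
  shows "t ^ 4 \<le> (73/100) * t"
proof -
  have "t ^ 3 \<le> (9/10) ^ 3"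
    using assms by (intro power_mono) auto
  then have "t * t ^ 3 \<le> t * (73/100)"
    using assms by (intro mult_left_mono) (auto simp: power3_eq_cube)
  then show ?thesis
    by (simp add: eval_nat_numeral)
qed

text \<open>The offset has modulus at least 3.9 here, while the quartic term stays below
  0.66.\<close>

lemma skew_escape_near_0:
  assumes "norm (fst x) \<le> 13/100" "norm (snd x) \<le> 9/10"
  shows "norm (snd (skew x)) > 2"
  using offset_near_0[OF assms(1)] norm_snd_skew_ge(2)[of x] pow4_le[OF norm_ge_zero assms(2)] assms
  by linarith

lemma skew_attracted_near_1:
  assumes "norm (fst x - 1) \<le> e" "e \<le> 1/100" "norm (snd x) \<le> 9/10"
  shows "norm (snd (skew x)) \<le> (73/100) * norm (snd x) + 12 * e"
  using offset_near_1[of "fst x" e] norm_snd_skew_le[of x] pow4_le[OF norm_ge_zero assms(3)] assms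
  by linarith

text \<open>For \<open>s = 0\<close> only the points that escape in \<open>z\<close> or in \<open>w\<close> remain. The part \<open>norm w < s\<close> is
  attracted to \<open>w = 0\<close> as long as \<open>z\<close> stays near \<open>1\<close>, and escapes otherwise.\<close>

definition trap :: "real \<Rightarrow> (complex \<times> complex) set" where
  "trap s = {x. norm (fst x) > 101/100 \<or> norm (snd x) < s \<or> norm (snd x) > 2}"

text \<open>For positive \<open>s\<close>, a fibre step near \<open>z = 1\<close> yields at most
  \<open>0.73 * s + 0.12\<close>, which is below \<open>s\<close> once \<open>s >= 1/2\<close>. The
  upper bound 9/10 is the range of the two fibre estimates.\<close>

lemma skew_trap:
  assumes s: "s = 0 \<or> 1/2 \<le> s \<and> s \<le> 9/10" and x: "x \<in> trap s"
  shows "skew x \<in> trap s"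
proof (cases "norm (base_map (fst x)) \<le> 101/100")
  case False
  then show ?thesis by (simp add: trap_def)
next
  case True
  have z: "norm (fst x) \<le> 101/100"
  proof (rule ccontr)
    assume "\<not> ?thesis"
    with base_map_escape[of "fst x"] True show False by simp
  qed
  consider "norm (snd x) > 2" | "norm (snd x) < s"
    using x z by (auto simp: trap_def)
  then show ?thesis
  proof cases
    case 1
    then show ?thesis
      using skew_escape[of x] z by (auto simp: trap_def)
  next
    case 2
    \<comment> \<open>The case \<open>s = 0\<close> is excluded because a norm lies below
      \<open>s\<close>.\<close>
    then have s: "1/2 \<le> s" "s \<le> 9/10"
      using s by (auto simp: not_less[symmetric])
    from base_map_bounded_cases[OF True] show ?thesis
    proof
      assume "norm (fst x) \<le> 13/100"
      then show ?thesis
        using skew_escape_near_0[of x] 2 s by (auto simp: trap_def)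
    next
      assume "norm (fst x - 1) \<le> 1/100"
      then have "norm (snd (skew x)) \<le> (73/100) * norm (snd x) + 12 * (1/100)"
        using 2 s by (intro skew_attracted_near_1) auto
      then have "norm (snd (skew x)) < s"
        using 2 s by simp
      then show ?thesis by (simp add: trap_def)
    qed
  qed
qed

lemma skew_trap_iterate:
  assumes "s = 0 \<or> 1/2 \<le> s \<and> s \<le> 9/10" "x \<in> trap s"
  shows "(skew ^^ n) x \<in> trap s"
  using assms by (induction n) (auto intro: skew_trap)

lemma fst_skew_iterate: "fst ((skew ^^ n) x) = (base_map ^^ n) (fst x)"
  by (induction n) auto

lemma continuous_on_base_map [continuous_intros]:
  "continuous_on A f \<Longrightarrow> continuous_on A (\<lambda>x. base_map (f x))"
  unfolding base_map_def by (intro continuous_intros)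

lemma continuous_on_skew: "continuous_on A skew"
  unfolding skew_def by (intro continuous_intros)

lemma open_trap: "open (trap s)"
  unfolding trap_def by (intro open_Collect_disj open_Collect_less continuous_intros)


section \<open>The nonwandering set\<close>

lemma nonwanderingE:
  assumes "x \<in> nonwandering f" "open U" "x \<in> U"
  obtains y n where "n \<ge> 1" "y \<in> U" "(f ^^ n) y \<in> U"
proof -
  obtain n where "n \<ge> 1" "(f ^^ n) ` U \<inter> U \<noteq> {}"
    using assms unfolding nonwandering_def by blast
  then show ?thesis
    using that by blast
qed

lemma closed_nonwandering: "closed (nonwandering f)"
proof -
  have "closure (nonwandering f) \<subseteq> nonwandering f"
  proof
    fix x assume x: "x \<in> closure (nonwandering f)"
    show "x \<in> nonwandering f"
      unfolding nonwandering_def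
    proof safe
      fix U assume U: "open U" "x \<in> U"
      then obtain y where "y \<in> nonwandering f" "y \<in> U"
        using x unfolding closure_iff_nhds_not_empty by blast
      with U show "\<exists>n\<ge>1. (f ^^ n) ` U \<inter> U \<noteq> {}"
        unfolding nonwandering_def by blast
    qed
  qed
  then show ?thesis
    using closure_subset_eq by blast
qed

lemma nonwandering_step:
  assumes f: "continuous_on UNIV f" and x: "x \<in> nonwandering f"
  shows "f x \<in> nonwandering f"
  unfolding nonwandering_def
proof safe
  fix U assume U: "open U" "f x \<in> U"
  have "open (f -` U)"
    using f U by (simp add: continuous_on_open_vimage)
  with x U obtain n y where "n \<ge> 1" "f y \<in> U" "f ((f ^^ n) y) \<in> U"
    by (elim nonwanderingE[of x f "f -` U"]) auto
  then show "\<exists>n\<ge>1. (f ^^ n) ` U \<inter> U \<noteq> {}"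
    by (metis disjoint_iff funpow_swap1 image_eqI)
qed

lemma nonwandering_iterate:
  assumes "continuous_on UNIV f" "x \<in> nonwandering f"
  shows "(f ^^ n) x \<in> nonwandering f"
  using assms by (induction n) (auto intro: nonwandering_step)

text \<open>A nonwandering point cannot cross the boundary of a trapping region in one step.\<close>

lemma nonwandering_no_entry:
  assumes f: "continuous_on UNIV f" and x: "x \<in> nonwandering f"
    and W: "open W" "\<And>y. y \<in> W \<Longrightarrow> f y \<in> W" and fx: "f x \<in> W"
  shows "x \<in> closure W"
proof (rule ccontr)
  assume "x \<notin> closure W"
  moreover have "open (f -` W - closure W)"
    using f W by (auto intro!: open_Diff simp: continuous_on_open_vimage)
  ultimately obtain n y where n: "n \<ge> 1" "y \<in> f -` W - closure W" "(f ^^ n) y \<in> f -` W - closure W"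
    using x fx by (elim nonwanderingE[of x f "f -` W - closure W"]) auto
  have "(f ^^ Suc k) y \<in> W" for k
    using n W by (induction k) auto
  from this[of "n - 1"] n closure_subset show False
    by (auto simp: subset_iff)
qed

section \<open>Locating the nonwandering set of the skew product\<close>

lemma base_map_iterate_escape:
  assumes "norm z \<ge> 101/100"
  shows "norm ((base_map ^^ n) z) \<ge> 2 ^ n * norm z"
proof (induction n)
  case (Suc n)
  have "1 * (101/100) \<le> 2 ^ n * norm z"
    using assms by (intro mult_mono) auto
  with Suc have "norm ((base_map ^^ n) z) \<ge> 101/100"
    by linarith
  from base_map_escape[OF this] Suc show ?case
    by simp
qed auto

text \<open>An orbit that has left the disc never comes back, so a bound at time \<open>n\<close>
  transfers to all earlier times.\<close>

lemma base_map_iterate_bounded: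
  assumes "norm ((base_map ^^ n) z) \<le> 101/100" "j \<le> n"
  shows "norm ((base_map ^^ j) z) \<le> 101/100"
proof (rule ccontr)
  assume *: "\<not> ?thesis"
  then have "norm ((base_map ^^ (n - j)) ((base_map ^^ j) z)) \<ge> 2 ^ (n - j) * norm ((base_map ^^ j) z)"
    by (intro base_map_iterate_escape) auto
  moreover have "2 ^ (n - j) * norm ((base_map ^^ j) z) \<ge> 1 * norm ((base_map ^^ j) z)"
    by (intro mult_right_mono) auto
  ultimately show False
    using * assms by (simp flip: funpow_add[unfolded o_def, THEN fun_cong])
qed

lemma skew_iterate_escape:
  assumes "norm (snd x) \<ge> 2" "\<And>j. j < n \<Longrightarrow> norm ((base_map ^^ j) (fst x)) \<le> 101/100"
  shows "norm (snd ((skew ^^ n) x)) \<ge> 2 ^ n * norm (snd x)"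
  using assms(2)
proof (induction n)
  case (Suc n)
  have "1 * 2 \<le> 2 ^ n * norm (snd x)"
    using assms by (intro mult_mono) auto
  with Suc have "norm (snd ((skew ^^ n) x)) \<ge> 2"
    by fastforce
  from skew_escape(1)[OF _ this] Suc show ?case
    by (fastforce simp: fst_skew_iterate)
qed auto

lemma nonwandering_skew_step: "x \<in> nonwandering skew \<Longrightarrow> skew x \<in> nonwandering skew"
  and nonwandering_skew_iterate: "x \<in> nonwandering skew \<Longrightarrow> (skew ^^ n) x \<in> nonwandering skew"
  by (auto intro: nonwandering_step nonwandering_iterate continuous_on_skew)

text \<open>The neighbourhood lies in an open annulus whose radii have ratio 2, and an orbit that at
  least doubles its modulus cannot return to it.\<close>

lemma nonwandering_skew_fst_le:
  assumes x: "x \<in> nonwandering skew"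
  shows "norm (fst x) \<le> 101/100"
proof (rule ccontr)
  assume *: "\<not> ?thesis"
  define U where "U = {y. 101/100 < norm (fst (y::complex\<times>complex)) \<and> (2/3) * norm (fst x) < norm (fst y)
    \<and> norm (fst y) < (4/3) * norm (fst x)}"
  have "open U"
    unfolding U_def by (intro open_Collect_conj open_Collect_less continuous_intros)
  moreover have "x \<in> U"
    using * by (auto simp: U_def)
  ultimately obtain y n where n: "n \<ge> 1" "y \<in> U" "(skew ^^ n) y \<in> U"
    by (rule nonwanderingE[OF x])
  then have "2 ^ n * norm (fst y) \<le> norm (fst ((skew ^^ n) y))"
    by (auto simp: U_def fst_skew_iterate intro: base_map_iterate_escape)
  moreover have "2 ^ 1 * norm (fst y) \<le> 2 ^ n * norm (fst y)"
    using n by (intro mult_right_mono power_increasing) auto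
  ultimately show False
    using n by (auto simp: U_def)
qed

lemma nonwandering_skew_fst:
  assumes x: "x \<in> nonwandering skew"
  shows "norm (fst x) < 101/100" "norm (fst x) \<le> 13/100 \<or> norm (fst x - 1) \<le> 1/100"
proof -
  have *: "norm (base_map (fst x)) \<le> 101/100"
    using nonwandering_skew_fst_le[OF nonwandering_skew_step[OF x]] by simp
  then show "norm (fst x) \<le> 13/100 \<or> norm (fst x - 1) \<le> 1/100"
    by (rule base_map_bounded_cases)
  show "norm (fst x) < 101/100"
    using base_map_escape[of "fst x"] * by linarith
qed

text \<open>The annulus argument again, now in the fibre. The bound on \<open>fst\<close> at the
  return time keeps the whole base orbit in the disc where the fibre escape estimate is
  valid.\<close>

lemma nonwandering_skew_snd_le:
  assumes x: "x \<in> nonwandering skew"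
  shows "norm (snd x) \<le> 2"
proof (rule ccontr)
  assume *: "\<not> ?thesis"
  define U where "U = {y. norm (fst (y::complex\<times>complex)) < 101/100 \<and> 2 < norm (snd y) \<and>
    (2/3) * norm (snd x) < norm (snd y) \<and> norm (snd y) < (4/3) * norm (snd x)}"
  have "open U"
    unfolding U_def by (intro open_Collect_conj open_Collect_less continuous_intros)
  moreover have "x \<in> U"
    using * nonwandering_skew_fst(1)[OF x] by (auto simp: U_def)
  ultimately obtain y n where n: "n \<ge> 1" "y \<in> U" "(skew ^^ n) y \<in> U"
    by (rule nonwanderingE[OF x])
  then have "2 ^ n * norm (snd y) \<le> norm (snd ((skew ^^ n) y))"
    using base_map_iterate_bounded[of n "fst y"]
    by (intro skew_iterate_escape) (auto simp: U_def fst_skew_iterate)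
  moreover have "2 ^ 1 * norm (snd y) \<le> 2 ^ n * norm (snd y)"
    using n by (intro mult_right_mono power_increasing) auto
  ultimately show False
    using n by (auto simp: U_def)
qed

lemma nonwandering_skew_snd_less:
  assumes x: "x \<in> nonwandering skew"
  shows "norm (snd x) < 2"
  using skew_escape(2)[of x] nonwandering_skew_snd_le[OF nonwandering_skew_step[OF x]]
    nonwandering_skew_fst_le[OF x] by linarith

text \<open>The base contracts by 0.87 near 0, and \<open>0.87 * 1.05 < 0.95\<close>, so the orbit
  cannot return to the window of moduli around \<open>norm (fst x)\<close> unless that norm is
  0.\<close>

lemma nonwandering_skew_fst_small:
  assumes x: "x \<in> nonwandering skew" and small: "norm (fst x) < 29/1000"
  shows "fst x = 0"
proof (rule ccontr)
  assume *: "fst x \<noteq> 0"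
  define U where "U = {y. norm (fst (y::complex\<times>complex)) < 29/1000 \<and>
    (95/100) * norm (fst x) < norm (fst y) \<and> norm (fst y) < (105/100) * norm (fst x)}"
  have "open U"
    unfolding U_def by (intro open_Collect_conj open_Collect_less continuous_intros)
  moreover have "x \<in> U"
    using * small by (auto simp: U_def)
  ultimately obtain y n where n: "n \<ge> 1" "y \<in> U" "(skew ^^ n) y \<in> U"
    by (rule nonwanderingE[OF x])
  have "norm ((base_map ^^ Suc k) (fst y)) \<le> (87/100) * norm (fst y)" for k
  proof (induction k)
    case 0
    then show ?case
      using base_map_contracts_at_0[of "fst y"] n by (auto simp: U_def)
  next
    case (Suc k)
    have "(87/100) * norm (fst y) \<le> 29/1000"
      using n by (auto simp: U_def)
    then have "norm ((base_map ^^ Suc (Suc k)) (fst y)) \<le> (87/100) * norm ((base_map ^^ Suc k) (fst y))"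
      using base_map_contracts_at_0[of "(base_map ^^ Suc k) (fst y)"] Suc by simp
    then show ?case
      using Suc norm_ge_zero[of "(base_map ^^ Suc k) (fst y)"] by linarith
  qed
  from this[of "n - 1"] n show False
    by (auto simp: U_def fst_skew_iterate simp del: funpow.simps)
qed

lemma nonwandering_skew_fst_step:
  assumes x: "x \<in> nonwandering skew" and "fst x \<noteq> 0"
  shows "fst (skew x) \<noteq> 0"
proof
  assume 0: "fst (skew x) = 0"
  \<comment> \<open>The radius stays below 29/1000 so that the closed ball is still covered by
    \<open>nonwandering_skew_fst_small\<close>.\<close>
  define W where "W = ball (0::complex) (28/1000) \<times> (UNIV :: complex set)"
  have "x \<in> closure W"
  proof (rule nonwandering_no_entry[OF continuous_on_skew x])
    show "skew y \<in> W" if "y \<in> W" for y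
      using that base_map_contracts_at_0[of "fst y"] norm_ge_zero[of "fst y"]
      by (simp add: W_def mem_Times_iff)
  qed (use 0 in \<open>auto simp: W_def mem_Times_iff intro: open_Times\<close>)
  then have "norm (fst x) \<le> 28/1000"
    by (simp add: W_def closure_Times mem_Times_iff)
  then show False
    using nonwandering_skew_fst_small[OF x] assms by auto
qed

lemma not_in_trap: "x \<notin> trap s \<longleftrightarrow> norm (fst x) \<le> 101/100 \<and> s \<le> norm (snd x) \<and> norm (snd x) \<le> 2"
  by (auto simp: trap_def)

lemma exponential_bound_imp_le_0:
  fixes a c :: real
  assumes "\<And>n. 2 ^ n * a \<le> c"
  shows "a \<le> 0"
proof (rule ccontr)
  assume a: "\<not> a \<le> 0"
  obtain n where "c / a < 2 ^ n"
    using real_arch_pow[of 2 "c / a"] by auto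
  then show False
    using assms[of n] a by (simp add: field_simps)
qed

text \<open>Small \<open>w\<close> persists along the orbit and would be thrown past 2 at any visit
  of the base point to the disc around 0. So the base orbit stays near the repelling point 1
  forever, which only 1 does.\<close>

lemma nonwandering_skew_snd_small_fst:
  assumes x: "x \<in> nonwandering skew" and small: "norm (snd x) < 9/10"
  shows "fst x = 1"
proof -
  define z where "z n = (base_map ^^ n) (fst x)" for n
  have *: "norm (z n - 1) \<le> 1/100" for n
  proof -
    have nw: "(skew ^^ n) x \<in> nonwandering skew"
      by (rule nonwandering_skew_iterate[OF x])
    have "(skew ^^ n) x \<in> trap (9/10)"
      using small by (intro skew_trap_iterate) (auto simp: trap_def)
    then have "norm (snd ((skew ^^ n) x)) \<le> 9/10"
      using nonwandering_skew_fst_le[OF nw] nonwandering_skew_snd_le[OF nw]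
      by (auto simp: trap_def)
    then have "\<not> norm (z n) \<le> 13/100"
      using skew_escape_near_0[of "(skew ^^ n) x"]
        nonwandering_skew_snd_le[OF nonwandering_skew_step[OF nw]]
      by (auto simp: z_def fst_skew_iterate)
    then show ?thesis
      using nonwandering_skew_fst(2)[OF nw] by (auto simp: z_def fst_skew_iterate)
  qed
  have "2 ^ n * norm (z 0 - 1) \<le> norm (z n - 1)" for n
  proof (induction n)
    case (Suc n)
    then show ?case
      using base_map_expands_at_1[OF *[of n]] by (simp add: z_def)
  qed auto
  then have "2 ^ n * norm (z 0 - 1) \<le> 1/100" for n
    using *[of n] order_trans by blast
  from exponential_bound_imp_le_0[OF this] show ?thesis
    by (simp add: z_def)
qed

lemma nonwandering_skew_snd_small:
  assumes x: "x \<in> nonwandering skew" and small: "norm (snd x) < 9/10"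
  shows "x = (1, 0)"
proof -
  have 1: "fst x = 1"
    by (rule nonwandering_skew_snd_small_fst[OF assms])
  have "snd x = 0"
  proof (rule ccontr)
    assume "snd x \<noteq> 0"
    \<comment> \<open>With \<open>e\<close> as unit, the window for \<open>norm w\<close> runs from
      99 to 101, and one fibre step sends it below \<open>0.73 * 101 + 12\<close>, which is less
      than 99.\<close>
    define e where "e = norm (snd x) / 100"
    have e: "0 < e" "e \<le> 1/100" and w: "norm (snd x) = 100 * e"
      using \<open>snd x \<noteq> 0\<close> small by (auto simp: e_def)
    define U where "U = {y. norm (fst (y::complex\<times>complex) - 1) < e \<and>
      99 * e < norm (snd y) \<and> norm (snd y) < 101 * e \<and> norm (snd y) < 9/10}"
    have "open U"
      unfolding U_def by (intro open_Collect_conj open_Collect_less continuous_intros)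
    moreover have "x \<in> U"
      using 1 e w small by (auto simp: U_def)
    ultimately obtain y n where n: "n \<ge> 1" "y \<in> U" "(skew ^^ n) y \<in> U"
      by (rule nonwanderingE[OF x])
    define Y where "Y j = (skew ^^ j) y" for j
    have Y_Suc: "Y (Suc j) = skew (Y j)" for j
      by (simp add: Y_def)
    \<comment> \<open>Outside \<open>trap 0\<close> is inherited backwards from the return point;
      inside \<open>trap (9/10)\<close> is inherited forwards from the start.\<close>
    have Y: "norm (fst (Y j)) \<le> 101/100" "norm (snd (Y j)) < 9/10" if "j \<le> n" for j
    proof -
      have "Y n \<notin> trap 0"
        using n e norm_near_1[of "fst (Y n)" e] by (auto simp: trap_def U_def Y_def)
      moreover have "Y n = (skew ^^ (n - j)) (Y j)"
        using that by (simp add: Y_def flip: funpow_add[unfolded o_def, THEN fun_cong])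
      ultimately have "Y j \<notin> trap 0"
        using skew_trap_iterate[of 0 "Y j" "n - j"] by auto
      moreover have "Y j \<in> trap (9/10)"
        unfolding Y_def using n by (intro skew_trap_iterate) (auto simp: trap_def U_def)
      ultimately show "norm (fst (Y j)) \<le> 101/100" "norm (snd (Y j)) < 9/10"
        by (auto simp: trap_def)
    qed
    \<comment> \<open>Induction backwards from the return time: stepping back under an expanding map
      only brings the base point closer to 1.\<close>
    have near: "norm (fst (Y j) - 1) \<le> e" if "j \<le> n" for j
      using that
    proof (induction rule: inc_induct)
      case base
      then show ?case using n by (auto simp: U_def Y_def)
    next
      case (step j)
      have "norm (base_map (fst (Y j))) \<le> 101/100"
        using Y(1)[of "Suc j"] step by (simp add: Y_Suc)
      moreover have "\<not> norm (fst (Y j)) \<le> 13/100"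
        using skew_escape_near_0[of "Y j"] Y(2)[of j] Y(2)[of "Suc j"] step by (auto simp: Y_Suc)
      ultimately have "norm (fst (Y j) - 1) \<le> 1/100"
        using base_map_bounded_cases by blast
      from base_map_expands_at_1[OF this] step show ?case
        using norm_ge_zero[of "fst (Y j) - 1"] unfolding Y_Suc fst_skew by linarith
    qed
    have down: "norm (snd (Y (Suc j))) \<le> 99 * e" if "j < n" "norm (snd (Y j)) \<le> 101 * e" for j
      using skew_attracted_near_1[OF near[of j]] that e Y(2)[of j] by (simp add: Y_Suc)
    have "norm (snd (Y j)) \<le> 101 * e" if "j \<le> n" for j
      using that
    proof (induction j)
      case 0
      then show ?case using n by (auto simp: U_def Y_def)
    next
      case (Suc j)
      then show ?case using down[of j] e by simp
    qed
    from down[OF _ this, of "n - 1"] n show False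
      by (auto simp: U_def Y_def simp del: funpow.simps)
  qed
  then show ?thesis
    using 1 by (simp add: prod_eq_iff)
qed

text \<open>A nonwandering preimage of the saddle would lie in the closure of
  \<open>trap (1/2)\<close>. The slack between 1/2 and 9/10 makes
  \<open>nonwandering_skew_snd_small\<close> apply to that closure.\<close>

lemma nonwandering_skew_step_neq:
  assumes x: "x \<in> nonwandering skew" and "x \<noteq> (1, 0)"
  shows "skew x \<noteq> (1, 0)"
proof
  assume "skew x = (1, 0)"
  then have "x \<in> closure (trap (1/2))"
    using skew_trap[of "1/2"]
    by (intro nonwandering_no_entry[OF continuous_on_skew x open_trap]) (auto simp: trap_def)
  moreover have "closure (trap (1/2)) \<subseteq>
      {y. norm (fst y) \<ge> 101/100 \<or> norm (snd y) \<le> 1/2 \<or> norm (snd y) \<ge> 2}"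
    by (intro closure_minimal closed_Collect_disj closed_Collect_le continuous_intros)
      (auto simp: trap_def)
  ultimately have "norm (snd x) \<le> 1/2"
    using nonwandering_skew_fst(1)[OF x] nonwandering_skew_snd_less[OF x] by auto
  then show False
    using nonwandering_skew_snd_small[OF x] assms by auto
qed

lemma skew_fixed [simp]: "skew (1, 0) = (1, 0)"
  by (simp add: skew_def)

lemma compact_nonwandering_skew: "compact (nonwandering skew)"
  unfolding compact_eq_bounded_closed
proof
  have "nonwandering skew \<subseteq> cball 0 2 \<times> cball 0 2"
    using nonwandering_skew_fst_le nonwandering_skew_snd_le by (force simp: mem_Times_iff)
  then show "bounded (nonwandering skew)"
    by (rule bounded_subset[rotated]) (intro bounded_Times bounded_cball)
qed (rule closed_nonwandering)


section \<open>Hyperbolicity\<close>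

definition base_deriv :: "complex \<Rightarrow> complex" where
  "base_deriv z = 3003 * z\<^sup>2 - 4000 * z ^ 3"

definition skew_deriv :: "complex \<times> complex \<Rightarrow> complex \<times> complex \<Rightarrow> complex \<times> complex" where
  "skew_deriv x v = (base_deriv (fst x) * fst v, 8 * fst x * fst v + 4 * snd x ^ 3 * snd v)"

lemma skew_has_derivative: "(skew has_derivative skew_deriv x) (at x)"
  unfolding skew_def base_map_def
  by (rule derivative_eq_intros refl ext | simp)+
    (simp add: skew_deriv_def base_deriv_def fun_eq_iff algebra_simps eval_nat_numeral)

lemma norm_base_deriv: "norm (base_deriv z) = norm z ^ 2 * norm (3003 - 4000 * z)"
proof -
  have "base_deriv z = z\<^sup>2 * (3003 - 4000 * z)"
    by (simp add: base_deriv_def algebra_simps eval_nat_numeral)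
  then show ?thesis
    by (simp only: norm_mult norm_power)
qed

lemma base_deriv_near_1:
  assumes "norm (z - 1) \<le> 1/100"
  shows "norm (base_deriv z) \<ge> 900"
proof -
  have b: "99/100 \<le> norm z"
    using norm_near_1[OF assms] by auto
  then have "norm z ^ 2 \<ge> (99/100) ^ 2"
    by (intro power_mono) auto
  moreover have "norm (4000 * z) - norm (3003::complex) \<le> norm (4000 * z - 3003)"
    by (rule norm_triangle_ineq2)
  then have "norm (3003 - 4000 * z) \<ge> 957"
    using b by (simp add: norm_mult norm_minus_commute)
  ultimately have "norm z ^ 2 * norm (3003 - 4000 * z) \<ge> (99/100) ^ 2 * 957"
    by (intro mult_mono) auto
  then show ?thesis
    by (simp add: norm_base_deriv power2_eq_square)
qed

lemma base_deriv_near_0: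
  assumes "28/1000 \<le> norm z" "norm z \<le> 13/100"
  shows "norm (base_deriv z) \<ge> 19/10"
proof -
  have "norm z ^ 2 \<ge> (28/1000) ^ 2"
    using assms by (intro power_mono) auto
  moreover have "norm (3003::complex) - norm (4000 * z) \<le> norm (3003 - 4000 * z)"
    by (rule norm_triangle_ineq2)
  then have "norm (3003 - 4000 * z) \<ge> 2483"
    using assms by (simp add: norm_mult norm_minus_commute)
  ultimately have "norm z ^ 2 * norm (3003 - 4000 * z) \<ge> (28/1000) ^ 2 * 2483"
    by (intro mult_mono) auto
  then show ?thesis
    by (simp add: norm_base_deriv power2_eq_square)
qed

text \<open>Given by explicit inequalities rather than through the nonwandering set, because
  shadowing needs it along orbits that merely return close to their start.\<close>

definition expanding_region :: "(complex \<times> complex) set" where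
  "expanding_region = {x. norm (snd x) \<le> 2 \<and>
     (norm (fst x - 1) \<le> 1/100 \<and> 8/10 \<le> norm (snd x) \<or>
      28/1000 \<le> norm (fst x) \<and> norm (fst x) \<le> 13/100 \<and> 11/10 \<le> norm (snd x))}"

text \<open>Since \<open>(11/10) ^ 4 <= 3/2\<close>, a smaller \<open>w\<close> would be pushed past
  2 by the offset of modulus at least 3.9.\<close>

lemma norm_snd_near_0:
  assumes "norm (fst x) \<le> 13/100" "norm (snd (skew x)) \<le> 2"
  shows "11/10 \<le> norm (snd x)"
proof (rule ccontr)
  assume "\<not> ?thesis"
  then have "norm (snd x) ^ 4 \<le> (11/10) ^ 4"
    by (intro power_mono) auto
  then have "norm (snd x) ^ 4 \<le> 3/2"
    by (simp add: eval_nat_numeral)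
  then show False
    using norm_snd_skew_ge(2)[of x] offset_near_0[OF assms(1)] assms(2) by linarith
qed

lemma expanding_regionI:
  assumes "x \<notin> trap (8/10)" "skew x \<notin> trap 0" "28/1000 \<le> norm (fst x)"
  shows "x \<in> expanding_region"
  using base_map_bounded_cases[of "fst x"] norm_snd_near_0[of x] assms
  by (auto simp: not_in_trap expanding_region_def)

text \<open>Here \<open>a\<close>, \<open>b\<close> are the sizes of the base and fibre components
  of a vector, \<open>s\<close>, \<open>t\<close> those of its image, and \<open>9 * a\<close>
  bounds the shear of the triangular derivative. If the shear swallows the fibre gain, the base gain
  suffices; otherwise a square is completed.\<close>

lemma triangular_expansion_near_1:
  fixes a b s t :: real
  assumes "0 \<le> a" "0 \<le> b" "0 \<le> s" "0 \<le> t" "800 * a \<le> s" "2 * b \<le> t + 9 * a"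
  shows "(9/4) * (a\<^sup>2 + b\<^sup>2) \<le> s\<^sup>2 + t\<^sup>2"
proof -
  have s: "(800 * a)\<^sup>2 \<le> s\<^sup>2"
    using assms by (intro power_mono) auto
  show ?thesis
  proof (cases "2 * b \<le> 9 * a")
    case True
    then have "(2 * b)\<^sup>2 \<le> (9 * a)\<^sup>2"
      using assms by (intro power_mono) auto
    then have "4 * b\<^sup>2 \<le> 81 * a\<^sup>2"
      by (simp add: power_mult_distrib)
    moreover have "640000 * a\<^sup>2 \<le> s\<^sup>2"
      using s by (simp add: power_mult_distrib)
    moreover have "4 * B \<le> 81 * A \<Longrightarrow> 640000 * A \<le> S \<Longrightarrow> 0 \<le> A \<Longrightarrow> 0 \<le> T \<Longrightarrow>
        (9/4) * (A + B) \<le> S + T" for A B S T :: real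
      by argo
    ultimately show ?thesis
      using zero_le_power2 by blast
  next
    case False
    then have "(2 * b - 9 * a)\<^sup>2 \<le> t\<^sup>2"
      using assms by (intro power_mono) auto
    moreover have "(2 * b - 9 * a)\<^sup>2 + (800 * a)\<^sup>2 - (9/4) * (a\<^sup>2 + b\<^sup>2) =
        (b - 18 * a)\<^sup>2 + (3/4) * b\<^sup>2 + (640081 - 9/4 - 324) * a\<^sup>2"
      by (simp add: power2_eq_square field_simps)
    moreover have "\<dots> \<ge> 0"
      by simp
    ultimately show ?thesis
      using s by linarith
  qed
qed

text \<open>The same scheme with weak base expansion, compensated by stronger fibre expansion and a
  smaller shear.\<close>

lemma triangular_expansion_near_0:
  fixes a b s t :: real
  assumes "0 \<le> a" "0 \<le> b" "0 \<le> s" "0 \<le> t" "(17/10) * a \<le> s" "5 * b \<le> t + (11/10) * a"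
  shows "(9/4) * (a\<^sup>2 + b\<^sup>2) \<le> s\<^sup>2 + t\<^sup>2"
proof -
  have s: "((17/10) * a)\<^sup>2 \<le> s\<^sup>2"
    using assms by (intro power_mono) auto
  show ?thesis
  proof (cases "5 * b \<le> (11/10) * a")
    case True
    then have "(5 * b)\<^sup>2 \<le> ((11/10) * a)\<^sup>2"
      using assms by (intro power_mono) auto
    then have "25 * b\<^sup>2 \<le> (121/100) * a\<^sup>2"
      by (simp add: power_mult_distrib power_divide)
    moreover have "(289/100) * a\<^sup>2 \<le> s\<^sup>2"
      using s by (simp add: power_mult_distrib power_divide)
    moreover have "25 * B \<le> (121/100) * A \<Longrightarrow> (289/100) * A \<le> S \<Longrightarrow> 0 \<le> A \<Longrightarrow> 0 \<le> T \<Longrightarrow>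
        (9/4) * (A + B) \<le> S + T" for A B S T :: real
      by argo
    ultimately show ?thesis
      using zero_le_power2 by blast
  next
    case False
    then have "(5 * b - (11/10) * a)\<^sup>2 \<le> t\<^sup>2"
      using assms by (intro power_mono) auto
    \<comment> \<open>The coefficient 55/13 is \<open>11 / (2 * (13/10))\<close>, matching the mixed
      term \<open>- 11 * a * b\<close>; the two leftover coefficients are positive.\<close>
    moreover have "(5 * b - (11/10) * a)\<^sup>2 + ((17/10) * a)\<^sup>2 - (9/4) * (a\<^sup>2 + b\<^sup>2) =
        (13/10 * a - 55/13 * b)\<^sup>2 + (16/100) * a\<^sup>2 + (91/4 - (55/13)\<^sup>2) * b\<^sup>2"
      by (simp add: power2_eq_square field_simps)
    moreover have "\<dots> \<ge> 0"
      by (intro add_nonneg_nonneg mult_nonneg_nonneg) (auto simp: power2_eq_square)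
    ultimately show ?thesis
      using s by linarith
  qed
qed

lemma expanding_region_cases [consumes 1, case_names near_1 near_0]:
  assumes "x \<in> expanding_region"
  obtains "norm (fst x - 1) \<le> 1/100" "8/10 \<le> norm (snd x)" "norm (snd x) \<le> 2"
    | "28/1000 \<le> norm (fst x)" "norm (fst x) \<le> 13/100" "11/10 \<le> norm (snd x)" "norm (snd x) \<le> 2"
  using assms by (auto simp: expanding_region_def)

lemma norm_cube_ge:
  fixes w :: complex
  shows "8/10 \<le> norm w \<Longrightarrow> norm (4 * w ^ 3) \<ge> 204/100"
    and "11/10 \<le> norm w \<Longrightarrow> norm (4 * w ^ 3) \<ge> 53/10"
  using power_mono[of "8/10" "norm w" 3] power_mono[of "11/10" "norm w" 3]
  by (simp_all add: norm_mult norm_power power3_eq_cube)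

lemma norm_pair_expand:
  fixes u v :: "complex \<times> complex"
  assumes "(9/4) * ((norm (fst v))\<^sup>2 + (norm (snd v))\<^sup>2) \<le> (norm (fst u))\<^sup>2 + (norm (snd u))\<^sup>2"
  shows "(3/2) * norm v \<le> norm u"
proof (rule power2_le_imp_le)
  have "norm x ^ 2 = (norm (fst x))\<^sup>2 + (norm (snd x))\<^sup>2" for x :: "complex \<times> complex"
    by (cases x) (simp add: norm_Pair)
  then show "((3/2) * norm v)\<^sup>2 \<le> (norm u)\<^sup>2"
    using assms by (simp add: power_mult_distrib power2_eq_square)
qed auto

lemma skew_deriv_expands:
  assumes "x \<in> expanding_region"
  shows "norm (skew_deriv x v) \<ge> (3/2) * norm v"
proof (rule norm_pair_expand)
  define u where "u = skew_deriv x v"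
  have 1: "norm (fst u) = norm (base_deriv (fst x)) * norm (fst v)"
    by (simp add: u_def skew_deriv_def norm_mult)
  have "norm (4 * snd x ^ 3 * snd v) \<le> norm (snd u) + norm (8 * fst x * fst v)"
    using norm_triangle_ineq4[of "snd u" "8 * fst x * fst v"] by (simp add: u_def skew_deriv_def)
  then have 2: "norm (4 * snd x ^ 3) * norm (snd v) \<le> norm (snd u) + 8 * norm (fst x) * norm (fst v)"
    by (simp add: norm_mult)
  show "(9/4) * ((norm (fst v))\<^sup>2 + (norm (snd v))\<^sup>2) \<le> (norm (fst u))\<^sup>2 + (norm (snd u))\<^sup>2"
    using assms
  proof (cases x rule: expanding_region_cases)
    case near_1
    have "8 * norm (fst x) * norm (fst v) \<le> 9 * norm (fst v)"
      using norm_near_1[OF near_1(1)] by (intro mult_right_mono) auto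
    moreover have "2 * norm (snd v) \<le> norm (4 * snd x ^ 3) * norm (snd v)"
      using norm_cube_ge(1)[OF near_1(2)] by (intro mult_right_mono) auto
    moreover have "800 * norm (fst v) \<le> norm (base_deriv (fst x)) * norm (fst v)"
      using base_deriv_near_1[OF near_1(1)] by (intro mult_right_mono) auto
    ultimately have "2 * norm (snd v) \<le> norm (snd u) + 9 * norm (fst v)"
      "800 * norm (fst v) \<le> norm (fst u)"
      using 1 2 by linarith+
    then show ?thesis
      by (intro triangular_expansion_near_1) auto
  next
    case near_0
    have "8 * norm (fst x) * norm (fst v) \<le> (11/10) * norm (fst v)"
      using near_0 by (intro mult_right_mono) auto
    moreover have "5 * norm (snd v) \<le> norm (4 * snd x ^ 3) * norm (snd v)"
      using norm_cube_ge(2)[OF near_0(3)] by (intro mult_right_mono) auto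
    moreover have "(17/10) * norm (fst v) \<le> norm (base_deriv (fst x)) * norm (fst v)"
      using base_deriv_near_0[OF near_0(1,2)] by (intro mult_right_mono) auto
    ultimately have "5 * norm (snd v) \<le> norm (snd u) + (11/10) * norm (fst v)"
      "(17/10) * norm (fst v) \<le> norm (fst u)"
      using 1 2 by linarith+
    then show ?thesis
      by (intro triangular_expansion_near_0) auto
  qed
qed

lemma nonwandering_expanding_region:
  assumes x: "x \<in> nonwandering skew" "x \<noteq> (1, 0)" "fst x \<noteq> 0"
  shows "x \<in> expanding_region"
proof (rule expanding_regionI)
  show "skew x \<notin> trap 0"
    using nonwandering_skew_fst_le[OF nonwandering_skew_step[OF x(1)]]
      nonwandering_skew_snd_le[OF nonwandering_skew_step[OF x(1)]] by (simp add: not_in_trap)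
  show "x \<notin> trap (8/10)"
    using nonwandering_skew_fst_le[OF x(1)] nonwandering_skew_snd_le[OF x(1)]
      nonwandering_skew_snd_small[OF x(1)] x(2) unfolding not_in_trap by linarith
  show "28/1000 \<le> norm (fst x)"
    using nonwandering_skew_fst_small[OF x(1)] x(3) by force
qed

lemma nonwandering_fiber_0:
  assumes x: "x \<in> nonwandering skew" "fst x = 0"
  shows "11/10 \<le> norm (snd x)"
  using x nonwandering_skew_snd_le[OF nonwandering_skew_step[OF x(1)]]
  by (intro norm_snd_near_0) auto

section \<open>The invariant splitting\<close>

definition stable_space :: "complex \<times> complex \<Rightarrow> (complex \<times> complex) set" where
  "stable_space x = (if x = (1, 0) then {v. fst v = 0} else if fst x = 0 then {v. snd v = 0} else {0})"

text \<open>At the saddle the eigenvalue is \<open>- 997\<close>, and its eigenvectors satisfy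
  \<open>8 * fst v = - 997 * snd v\<close>, whence the slope \<open>- 8/997\<close>.\<close>

definition unstable_space :: "complex \<times> complex \<Rightarrow> (complex \<times> complex) set" where
  "unstable_space x = (if x = (1, 0) then {v. snd v = - 8/997 * fst v}
     else if fst x = 0 then {v. fst v = 0} else UNIV)"

text \<open>The saddle is superattracting along its fibre, and the fibre over 0 is superattracting
  in the base direction, so stable vectors die after a single step.\<close>

lemma skew_deriv_stable: "v \<in> stable_space x \<Longrightarrow> skew_deriv x v = 0"
  by (auto simp: stable_space_def skew_deriv_def base_deriv_def prod_eq_iff split: if_splits)

lemma skew_deriv_fixed:
  "v \<in> unstable_space (1, 0) \<Longrightarrow> skew_deriv (1, 0) v = (- 997) *\<^sub>R v"
  by (simp add: unstable_space_def skew_deriv_def base_deriv_def prod_eq_iff scaleR_conv_of_real)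

lemma skew_deriv_unstable_expands:
  assumes x: "x \<in> nonwandering skew" and v: "v \<in> unstable_space x"
  shows "norm (skew_deriv x v) \<ge> (3/2) * norm v"
proof -
  consider "x = (1, 0)" | "x \<noteq> (1, 0)" "fst x = 0" | "x \<noteq> (1, 0)" "fst x \<noteq> 0"
    by blast
  then show ?thesis
  proof cases
    case 1
    have "norm (skew_deriv x v) = 997 * norm v"
      using v unfolding 1 by (simp add: skew_deriv_fixed del: scaleR_minus_left)
    then show ?thesis
      by (simp add: mult_right_mono)
  next
    case 2
    then have "fst v = 0"
      using v by (simp add: unstable_space_def)
    then have "norm (skew_deriv x v) = norm (4 * snd x ^ 3) * norm (snd v)" "norm v = norm (snd v)"
      using 2 by (auto simp: skew_deriv_def norm_prod_def norm_mult)
    moreover have "norm (4 * snd x ^ 3) * norm (snd v) \<ge> (3/2) * norm (snd v)"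
      using norm_cube_ge(2)[OF nonwandering_fiber_0[OF x 2(2)]] by (intro mult_right_mono) auto
    ultimately show ?thesis
      by simp
  next
    case 3
    then show ?thesis
      using skew_deriv_expands[OF nonwandering_expanding_region[OF x]] by blast
  qed
qed

lemma skew_deriv_unstable_image:
  assumes x: "x \<in> nonwandering skew"
  shows "skew_deriv x ` unstable_space x = unstable_space (skew x)"
proof -
  consider "x = (1, 0)" | "x \<noteq> (1, 0)" "fst x = 0" | "x \<noteq> (1, 0)" "fst x \<noteq> 0"
    by blast
  then show ?thesis
  proof cases
    case 1
    have "v \<in> skew_deriv (1, 0) ` unstable_space (1, 0)" if "v \<in> unstable_space (1, 0)" for v
    proof (rule image_eqI)
      show *: "(- 1/997) *\<^sub>R v \<in> unstable_space (1, 0)"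
        using that by (simp add: unstable_space_def scaleR_conv_of_real)
      show "v = skew_deriv (1, 0) ((- 1/997) *\<^sub>R v)"
        by (subst skew_deriv_fixed[OF *]) simp
    qed
    moreover have "skew_deriv (1, 0) v \<in> unstable_space (1, 0)" if "v \<in> unstable_space (1, 0)" for v
      using that skew_deriv_fixed[OF that] by (simp add: unstable_space_def scaleR_conv_of_real)
    ultimately show ?thesis
      unfolding 1 by auto
  next
    case 2
    then have x': "skew x \<noteq> (1, 0)" "fst (skew x) = 0"
      using nonwandering_skew_step_neq[OF x] by auto
    have "snd x \<noteq> 0"
      using nonwandering_fiber_0[OF x 2(2)] by auto
    then have "v \<in> skew_deriv x ` {v. fst v = 0}" if "fst v = 0" for v
      using that
      by (intro image_eqI[of _ _ "(0, snd v / (4 * snd x ^ 3))"]) (simp_all add: skew_deriv_def prod_eq_iff)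
    then have "skew_deriv x ` {v. fst v = 0} = {v. fst v = 0}"
      by (auto simp: skew_deriv_def)
    then show ?thesis
      using 2 x' by (simp add: unstable_space_def)
  next
    case 3
    then have x': "skew x \<noteq> (1, 0)" "fst (skew x) \<noteq> 0"
      using nonwandering_skew_step_neq[OF x] nonwandering_skew_fst_step[OF x] by auto
    have nz: "snd x \<noteq> 0" "base_deriv (fst x) \<noteq> 0"
      using nonwandering_expanding_region[OF x 3]
      by (cases rule: expanding_region_cases; use base_deriv_near_1[of "fst x"] base_deriv_near_0[of "fst x"] in auto)+
    have "v = skew_deriv x (fst v / base_deriv (fst x),
      (snd v - 8 * fst x * (fst v / base_deriv (fst x))) / (4 * snd x ^ 3))" for v
      using nz by (simp add: skew_deriv_def prod_eq_iff)
    then have "surj (skew_deriv x)"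
      by (rule surjI[OF sym])
    then show ?thesis
      using 3 x' by (simp add: unstable_space_def)
  qed
qed

primrec skew_iterate_deriv :: "nat \<Rightarrow> complex \<times> complex \<Rightarrow> complex \<times> complex \<Rightarrow> complex \<times> complex" where
  "skew_iterate_deriv 0 x v = v"
| "skew_iterate_deriv (Suc n) x v = skew_deriv ((skew ^^ n) x) (skew_iterate_deriv n x v)"

lemma skew_iterate_has_derivative: "((skew ^^ n) has_derivative skew_iterate_deriv n x) (at x)"
proof (induction n)
  case 0
  have "skew_iterate_deriv 0 x = (\<lambda>v. v)" by auto
  then show ?case by (simp add: id_def)
next
  case (Suc n)
  have "skew_iterate_deriv (Suc n) x = skew_deriv ((skew ^^ n) x) \<circ> skew_iterate_deriv n x"
    by auto
  then show ?case
    using diff_chain_at[OF Suc skew_has_derivative] by (simp only: funpow.simps)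
qed

lemma skew_iterate_deriv_stable:
  assumes "v \<in> stable_space x"
  shows "skew_iterate_deriv (Suc n) x v = 0"
proof (induction n)
  case (Suc n)
  then show ?case
    by (subst skew_iterate_deriv.simps) (simp add: skew_deriv_def zero_prod_def)
qed (simp add: skew_deriv_stable[OF assms])

lemma skew_iterate_deriv_unstable:
  assumes x: "x \<in> nonwandering skew" and v: "v \<in> unstable_space x"
  shows "skew_iterate_deriv n x v \<in> unstable_space ((skew ^^ n) x)"
    and "norm (skew_iterate_deriv n x v) \<ge> (3/2) ^ n * norm v"
proof (induction n)
  case 0
  { case 1 show ?case using v by simp }
  { case 2 show ?case by simp }
next
  case (Suc n)
  note nw = nonwandering_skew_iterate[OF x, of n]
  { case 1
    show ?case using skew_deriv_unstable_image[OF nw] Suc(1) by auto }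
  { case 2
    show ?case using skew_deriv_unstable_expands[OF nw Suc(1)] Suc(2) by simp }
qed

text \<open>On the nonwandering set the two cut-off factors take only the values \<open>0\<close> and \<open>1\<close>, so that this
  formula for the projection, which is visibly continuous, agrees with the definition by cases.\<close>

definition stable_proj :: "complex \<times> complex \<Rightarrow> complex \<times> complex \<Rightarrow> complex \<times> complex" where
  "stable_proj x v =
    (complex_of_real (max 0 (1 - norm (fst x) * (1000/29))) * fst v,
     complex_of_real (max 0 (1 - norm (snd x) * (10/9))) * (snd v + 8/997 * fst v))"

text \<open>The slopes 1000/29 and 10/9 are the reciprocals of the gaps in the nonwandering set, so
  each cut-off has vanished wherever its summand must be absent. The term
  \<open>8/997 * fst v\<close> makes the projection at the saddle run along the unstable
  line.\<close>

lemma stable_proj_splits: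
  assumes x: "x \<in> nonwandering skew"
  shows "a \<in> stable_space x \<and> v - a \<in> unstable_space x \<longleftrightarrow> a = stable_proj x v"
proof -
  consider "x = (1, 0)" | "x \<noteq> (1, 0)" "fst x = 0" | "x \<noteq> (1, 0)" "fst x \<noteq> 0"
    by blast
  then show ?thesis
  proof cases
    case 1
    then show ?thesis
      by (auto simp: stable_space_def unstable_space_def stable_proj_def prod_eq_iff algebra_simps)
  next
    case 2
    then have "norm (snd x) \<ge> 9/10"
      using nonwandering_skew_snd_small[OF x] by force
    then show ?thesis
      using 2 by (auto simp: stable_space_def unstable_space_def stable_proj_def prod_eq_iff max_def)
  next
    case 3
    then have "norm (snd x) \<ge> 9/10" "norm (fst x) \<ge> 29/1000"
      using nonwandering_skew_snd_small[OF x] nonwandering_skew_fst_small[OF x] by force+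
    then show ?thesis
      using 3 by (auto simp: stable_space_def unstable_space_def stable_proj_def prod_eq_iff max_def)
  qed
qed

lemma continuous_splitting_skew:
  "continuous_splitting (natural_extension skew (nonwandering skew))
     (\<lambda>h. stable_space (h 0)) (\<lambda>h. unstable_space (h 0))"
  unfolding continuous_splitting_def
proof (intro conjI ballI allI)
  fix h assume h: "h \<in> natural_extension skew (nonwandering skew)"
  show "csubspace2 (stable_space (h 0))" "csubspace2 (unstable_space (h 0))"
    by (auto simp: csubspace2_def stable_space_def unstable_space_def subspace_def scaleC2_def
        prod_eq_iff algebra_simps)
  have "h 0 \<in> nonwandering skew"
    using h by (simp add: natural_extension_def)
  then show "\<exists>!a. a \<in> stable_space (h 0) \<and> v - a \<in> unstable_space (h 0)" for v
    by (simp add: stable_proj_splits)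
next
  let ?H = "natural_extension skew (nonwandering skew)"
  have *: "continuous_on A (\<lambda>p. fst p (0::nat))" for A :: "((nat \<Rightarrow> complex \<times> complex) \<times> complex \<times> complex) set"
    by (rule continuous_on_compose2[OF continuous_on_product_coordinates[of 0] continuous_on_fst])
      (auto intro: continuous_on_id)
  have "continuous_on (?H \<times> UNIV) (\<lambda>p. stable_proj (fst p 0) (snd p))"
    unfolding stable_proj_def by (intro continuous_intros *)
  then show "continuous_on (?H \<times> UNIV)
      (\<lambda>(h, v). THE a. a \<in> stable_space (h 0) \<and> v - a \<in> unstable_space (h 0))"
    by (rule continuous_on_eq) (auto simp: natural_extension_def stable_proj_splits)
qed

lemma hyperbolic_skew: "hyperbolic_on skew (nonwandering skew)"
  unfolding hyperbolic_on_def
proof (rule exI[of _ "\<lambda>h. stable_space (h 0)"], rule exI[of _ "\<lambda>h. unstable_space (h 0)"],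
    intro conjI ballI)
  fix h assume "h \<in> natural_extension skew (nonwandering skew)"
  then have h: "h 0 \<in> nonwandering skew"
    by (simp add: natural_extension_def)
  have D: "frechet_derivative skew (at (h 0)) = skew_deriv (h 0)"
    using frechet_derivative_at[OF skew_has_derivative] by simp
  show "frechet_derivative skew (at (h 0)) ` stable_space (h 0) \<subseteq> stable_space (history_shift skew h 0)"
    unfolding D by (auto simp: skew_deriv_stable stable_space_def)
  show "frechet_derivative skew (at (h 0)) ` unstable_space (h 0) = unstable_space (history_shift skew h 0)"
    unfolding D by (simp add: skew_deriv_unstable_image[OF h] history_shift_def)
next
  have D: "frechet_derivative (skew ^^ n) (at x) = skew_iterate_deriv n x" for n x
    using frechet_derivative_at[OF skew_iterate_has_derivative] by simp
  show "\<exists>C>0. \<exists>r>1. \<forall>h\<in>natural_extension skew (nonwandering skew). \<forall>n\<ge>1.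
     (\<forall>v\<in>stable_space (h 0). norm (frechet_derivative (skew ^^ n) (at (h 0)) v) \<le> C / r ^ n * norm v) \<and>
     (\<forall>v\<in>unstable_space (h 0). norm (frechet_derivative (skew ^^ n) (at (h 0)) v) \<ge> r ^ n / C * norm v)"
  proof (rule exI[of _ 1], rule conjI, simp, rule exI[of _ "3/2"], intro conjI ballI allI impI)
    fix h n v
    assume "h \<in> natural_extension skew (nonwandering skew)" and n: "n \<ge> (1::nat)"
    then have h: "h 0 \<in> nonwandering skew"
      by (simp add: natural_extension_def)
    \<comment> \<open>This needs \<open>n >= 1\<close>: one step already kills a stable vector, so
      the left side is 0.\<close>
    { assume "v \<in> stable_space (h 0)"
      then show "norm (frechet_derivative (skew ^^ n) (at (h 0)) v) \<le> 1 / (3/2) ^ n * norm v"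
        using n skew_iterate_deriv_stable[of v "h 0" "n - 1"] unfolding D by simp }
    { assume "v \<in> unstable_space (h 0)"
      then show "norm (frechet_derivative (skew ^^ n) (at (h 0)) v) \<ge> (3/2) ^ n / 1 * norm v"
        using skew_iterate_deriv_unstable(2)[OF h] unfolding D by simp }
  qed auto
qed (rule continuous_splitting_skew)


section \<open>Density of periodic points\<close>

definition expanding_chart :: "('a::metric_space \<Rightarrow> 'a) \<Rightarrow> real \<Rightarrow> real \<Rightarrow> 'a \<Rightarrow> bool" where
  "expanding_chart f l r y \<longleftrightarrow> (\<exists>B. y \<in> B \<and> cball (f y) r \<subseteq> f ` B \<and>
     (\<forall>s\<in>B. \<forall>t\<in>B. l * dist s t \<le> dist (f s) (f t)))"

text \<open>Expansion on \<open>B\<close> gives injectivity there, and \<open>B\<close> covers the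
  ball, so an inverse branch exists on the ball and contracts by \<open>1 / l\<close>.\<close>

lemma expanding_chart_branch:
  assumes "expanding_chart f l r y" "l > 1" "r \<ge> 0"
  obtains g where "g (f y) = y" "\<And>s. s \<in> cball (f y) r \<Longrightarrow> f (g s) = s"
    "\<And>s t. s \<in> cball (f y) r \<Longrightarrow> t \<in> cball (f y) r \<Longrightarrow> dist (g s) (g t) \<le> dist s t / l"
proof -
  obtain B where B: "y \<in> B" "cball (f y) r \<subseteq> f ` B"
    "\<And>s t. s \<in> B \<Longrightarrow> t \<in> B \<Longrightarrow> l * dist s t \<le> dist (f s) (f t)"
    using assms unfolding expanding_chart_def by blast
  have in_B: "inv_into B f s \<in> B" "f (inv_into B f s) = s" if "s \<in> cball (f y) r" for s
    using inv_into_into[of s f B] f_inv_into_f[of s f B] B(2) that by blast+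
  show ?thesis
  proof
    have y: "f y \<in> cball (f y) r"
      using \<open>r \<ge> 0\<close> by simp
    have "l * dist (inv_into B f (f y)) y \<le> 0"
      using B(3)[OF in_B(1)[OF y] B(1)] in_B(2)[OF y] by simp
    then show "inv_into B f (f y) = y"
      using \<open>l > 1\<close> by (simp add: mult_le_0_iff)
    show "f (inv_into B f s) = s" if "s \<in> cball (f y) r" for s
      using in_B(2)[OF that] .
    show "dist (inv_into B f s) (inv_into B f t) \<le> dist s t / l"
      if "s \<in> cball (f y) r" "t \<in> cball (f y) r" for s t
      using B(3)[OF in_B(1)[OF that(1)] in_B(1)[OF that(2)]] in_B(2)[OF that(1)] in_B(2)[OF that(2)] \<open>l > 1\<close>
      by (simp add: field_simps)
  qed
qed

text \<open>A ball around \<open>y m = y 0\<close> is pulled back along the closed pseudo-orbit by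
  contracting inverse branches. The composite maps the ball into itself, and its Banach fixed point
  is periodic.\<close>

lemma periodic_shadowing:
  fixes f :: "'a::complete_space \<Rightarrow> 'a"
  assumes l: "l > 1" and d: "d \<ge> 0" "l / (l - 1) * d \<le> r"
    and chart: "\<And>j. j < m \<Longrightarrow> expanding_chart f l r (y j)"
    and jump: "\<And>j. j < m \<Longrightarrow> dist (f (y j)) (y (Suc j)) \<le> d"
    and m: "m \<ge> 1" "y m = y 0"
  shows "\<exists>x. (f ^^ m) x = x \<and> dist x (y 0) \<le> d / (l - 1)"
proof -
  \<comment> \<open>This \<open>e\<close> solves \<open>(e + d) / l = e\<close>: a ball of radius
    \<open>e\<close>, enlarged by one jump and contracted by one branch, fits into radius
    \<open>e\<close> again. The hypothesis on \<open>r\<close> says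
    \<open>e + d <= r\<close>.\<close>
  define e where "e = d / (l - 1)"
  have e: "e \<ge> 0" "(e + d) / l = e" "e + d \<le> r"
    using l d by (auto simp: e_def field_simps)
  then have r: "r \<ge> 0"
    using d by linarith
  \<comment> \<open>\<open>G\<close> is an inverse branch of the \<open>k\<close>-th iterate along
    the last \<open>k\<close> points of the pseudo-orbit.\<close>
  have "\<exists>G. G ` cball (y m) e \<subseteq> cball (y (m - k)) e \<and> (\<forall>s\<in>cball (y m) e. (f ^^ k) (G s) = s) \<and>
      (\<forall>s\<in>cball (y m) e. \<forall>t\<in>cball (y m) e. dist (G s) (G t) \<le> (1 / l) ^ k * dist s t)" if "k \<le> m" for k
    using that
  proof (induction k)
    case 0
    show ?case by (rule exI[of _ id]) auto
  next
    case (Suc k)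
    then obtain G where G: "\<And>s. s \<in> cball (y m) e \<Longrightarrow> G s \<in> cball (y (m - k)) e"
      "\<And>s. s \<in> cball (y m) e \<Longrightarrow> (f ^^ k) (G s) = s"
      "\<And>s t. s \<in> cball (y m) e \<Longrightarrow> t \<in> cball (y m) e \<Longrightarrow> dist (G s) (G t) \<le> (1 / l) ^ k * dist s t"
      unfolding image_subset_iff by (metis Suc_leD)
    define i where "i = m - Suc k"
    have i: "i < m" "Suc i = m - k"
      using Suc by (auto simp: i_def)
    obtain g where g: "g (f (y i)) = y i" "\<And>s. s \<in> cball (f (y i)) r \<Longrightarrow> f (g s) = s"
      "\<And>s t. s \<in> cball (f (y i)) r \<Longrightarrow> t \<in> cball (f (y i)) r \<Longrightarrow> dist (g s) (g t) \<le> dist s t / l"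
      using expanding_chart_branch[OF chart[OF i(1)] l r] by blast
    have near: "dist (f (y i)) (G s) \<le> e + d" if "s \<in> cball (y m) e" for s
      using dist_triangle[of "f (y i)" "G s" "y (Suc i)"] G(1)[OF that] jump[OF i(1)]
      by (simp add: i(2))
    then have in_ball: "G s \<in> cball (f (y i)) r" if "s \<in> cball (y m) e" for s
      using that e(3) by fastforce
    show ?case
    proof (rule exI[of _ "g \<circ> G"], intro conjI ballI subsetI)
      fix x assume "x \<in> (g \<circ> G) ` cball (y m) e"
      then obtain s where s: "s \<in> cball (y m) e" "x = g (G s)"
        by auto
      have "dist (g (f (y i))) (g (G s)) \<le> dist (f (y i)) (G s) / l"
        using in_ball[OF s(1)] e d by (intro g(3)) auto
      also have "\<dots> \<le> (e + d) / l"
        using near[OF s(1)] l by (intro divide_right_mono) auto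
      finally have "dist (y i) (g (G s)) \<le> e"
        unfolding g(1) e(2) .
      then show "x \<in> cball (y (m - Suc k)) e"
        using s by (simp add: i_def)
    next
      fix s assume s: "s \<in> cball (y m) e"
      show "(f ^^ Suc k) ((g \<circ> G) s) = s"
        using G(2)[OF s] g(2)[OF in_ball[OF s]] by (simp add: funpow_swap1)
      fix t assume t: "t \<in> cball (y m) e"
      have "dist (g (G s)) (g (G t)) \<le> dist (G s) (G t) / l"
        using in_ball s t by (intro g(3)) auto
      also have "\<dots> \<le> ((1 / l) ^ k * dist s t) / l"
        using G(3)[OF s t] l by (intro divide_right_mono) auto
      finally show "dist ((g \<circ> G) s) ((g \<circ> G) t) \<le> (1 / l) ^ Suc k * dist s t"
        by simp
    qed
  qed
  from this[of m] m obtain G where G: "G ` cball (y 0) e \<subseteq> cball (y 0) e"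
      "\<And>s. s \<in> cball (y 0) e \<Longrightarrow> (f ^^ m) (G s) = s"
      "\<forall>s\<in>cball (y 0) e. \<forall>t\<in>cball (y 0) e. dist (G s) (G t) \<le> (1 / l) ^ m * dist s t"
    by auto
  have "(1 / l) ^ m < 1"
    using l m by (simp add: power_less_one_iff)
  then have "\<exists>!x\<in>cball (y 0) e. G x = x"
    using l e G by (intro Banach_fix[where c="(1 / l) ^ m"]) (auto simp: complete_eq_closed)
  then obtain x where x: "x \<in> cball (y 0) e" "G x = x"
    by blast
  then have "(f ^^ m) x = x"
    using G(2)[OF x(1)] by simp
  moreover have "dist x (y 0) \<le> d / (l - 1)"
    using x(1) by (simp add: e_def dist_commute)
  ultimately show ?thesis
    by blast
qed

section \<open>Local inverses with explicit radii\<close>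

text \<open>A quantitative inverse function theorem: \<open>g\<close> differs from
  \<open>c * z\<close> by an error with Lipschitz constant \<open>k\<close>, and
  \<open>norm c\<close> exceeds \<open>k\<close> by at least \<open>mu\<close>.\<close>

lemma nearly_constant_derivative:
  fixes g :: "complex \<Rightarrow> complex"
  assumes g: "\<And>z. z \<in> cball z0 r \<Longrightarrow> (g has_field_derivative g' z) (at z)"
    and k: "\<And>z. z \<in> cball z0 r \<Longrightarrow> norm (g' z - c) \<le> k"
    and mu: "mu > 0" "mu + k \<le> norm c" and r: "r \<ge> 0"
  shows "x \<in> cball z0 r \<Longrightarrow> y \<in> cball z0 r \<Longrightarrow> mu * norm (x - y) \<le> norm (g x - g y)"
    and "t \<in> cball (g z0) (mu * r) \<Longrightarrow> \<exists>z\<in>cball z0 r. g z = t"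
proof -
  have k0: "k \<ge> 0"
    using k[of z0] r by (auto intro: order_trans[OF norm_ge_zero])
  have h: "norm ((g x - c * x) - (g y - c * y)) \<le> k * norm (x - y)"
    if "x \<in> cball z0 r" "y \<in> cball z0 r" for x y
  proof (rule field_differentiable_bound[of "cball z0 r" "\<lambda>z. g z - c * z" "\<lambda>z. g' z - c"])
    show "((\<lambda>z. g z - c * z) has_field_derivative g' z - c) (at z within cball z0 r)" if "z \<in> cball z0 r" for z
      by (rule has_field_derivative_at_within) (auto intro!: derivative_eq_intros g that)
  qed (use that k in auto)
  { assume x: "x \<in> cball z0 r" and y: "y \<in> cball z0 r"
    have "mu * norm (x - y) + k * norm (x - y) \<le> norm (c * (x - y))"
      using mult_right_mono[OF mu(2) norm_ge_zero[of "x - y"]] by (simp only: norm_mult distrib_right)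
    also have "c * (x - y) = (g x - g y) - ((g x - c * x) - (g y - c * y))"
      by (simp add: algebra_simps)
    also have "norm \<dots> \<le> norm (g x - g y) + k * norm (x - y)"
      using norm_triangle_ineq4 h[OF x y] by (meson add_left_mono order_trans)
    finally show "mu * norm (x - y) \<le> norm (g x - g y)"
      by simp }
  assume t: "t \<in> cball (g z0) (mu * r)"
  have c: "norm c > 0" "c \<noteq> 0"
    using mu k0 by auto
  \<comment> \<open>Fixed points of \<open>F\<close> are the solutions of \<open>g z = t\<close>,
    and \<open>F\<close> contracts by \<open>k / norm c\<close>.\<close>
  define F where "F z = (t - (g z - c * z)) / c" for z
  have F: "dist (F x) (F y) \<le> (k / norm c) * dist x y" if "x \<in> cball z0 r" "y \<in> cball z0 r" for x y
  proof -
    have "F x - F y = - (((g x - c * x) - (g y - c * y)) / c)"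
      by (simp add: F_def diff_divide_distrib)
    then show ?thesis
      using h[OF that] c by (simp add: dist_norm norm_divide divide_right_mono)
  qed
  have z0: "z0 \<in> cball z0 r"
    using r by simp
  have "\<exists>!z\<in>cball z0 r. F z = z"
  proof (rule Banach_fix[where c="k / norm c"])
    show "F ` cball z0 r \<subseteq> cball z0 r"
    proof safe
      fix z assume z: "z \<in> cball z0 r"
      have "F z0 - z0 = (t - g z0) / c"
        using c by (simp add: F_def field_simps)
      then have "dist (F z0) z0 \<le> mu * r / norm c"
        using t c by (simp add: dist_norm norm_divide norm_minus_commute divide_right_mono)
      moreover have "dist (F z) (F z0) \<le> k / norm c * r"
        using F[OF z z0] z k0 c
        by (elim order_trans) (intro mult_left_mono, auto simp: dist_commute)
      ultimately have "dist (F z) z0 \<le> k / norm c * r + mu * r / norm c"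
        using dist_triangle[of "F z" z0 "F z0"] by linarith
      also have "\<dots> = (mu + k) / norm c * r"
        using c by (simp add: field_simps)
      also have "\<dots> \<le> 1 * r"
        using mu c r by (intro mult_right_mono) auto
      finally show "F z \<in> cball z0 r"
        by (simp add: dist_commute)
    qed
  qed (use F k0 mu c r in \<open>auto simp: complete_eq_closed\<close>)
  then obtain z where "z \<in> cball z0 r" "F z = z"
    by blast
  moreover from this have "g z = t"
    using c by (simp add: F_def field_simps)
  ultimately show "\<exists>z\<in>cball z0 r. g z = t"
    by blast
qed

lemma base_map_has_field_derivative: "(base_map has_field_derivative base_deriv z) (at z)"
  unfolding base_map_def
  by (rule derivative_eq_intros refl | simp)+
    (simp add: base_deriv_def algebra_simps eval_nat_numeral)

lemma base_deriv_close:
  assumes "norm z0 \<le> 102/100" "norm z \<le> 102/100" "norm (z - z0) \<le> e"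
  shows "norm (base_deriv z - base_deriv z0) \<le> 20000 * e"
proof -
  have "norm (3003 * (z + z0) - 4000 * (z * z + z * z0 + z0 * z0)) \<le>
      3003 * (norm z + norm z0) + 4000 * (norm z * norm z + norm z * norm z0 + norm z0 * norm z0)"
    by (intro order_trans[OF norm_triangle_ineq4] add_mono)
      (auto simp: norm_mult intro!: norm_triangle_le add_mono)
  also have "\<dots> \<le> 3003 * (102/100 + 102/100) +
      4000 * ((102/100) * (102/100) + (102/100) * (102/100) + (102/100) * (102/100))"
    using assms by (intro add_mono mult_mono mult_left_mono) auto
  also have "\<dots> \<le> 20000"
    by simp
  finally have *: "norm (3003 * (z + z0) - 4000 * (z * z + z * z0 + z0 * z0)) \<le> 20000" .
  have "base_deriv z - base_deriv z0 =
      (3003 * (z + z0) - 4000 * (z * z + z * z0 + z0 * z0)) * (z - z0)"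
    by (simp add: base_deriv_def algebra_simps eval_nat_numeral)
  then show ?thesis
    using mult_mono[OF * assms(3)] by (simp add: norm_mult)
qed

lemma quartic_deriv_close:
  fixes w w0 :: complex
  assumes "norm w0 \<le> 21/10" "norm w \<le> 21/10" "norm (w - w0) \<le> e"
  shows "norm (4 * w ^ 3 - 4 * w0 ^ 3) \<le> 54 * e"
proof -
  have "norm (4 * (w * w + w * w0 + w0 * w0)) \<le>
      4 * (norm w * norm w + norm w * norm w0 + norm w0 * norm w0)"
    unfolding norm_mult norm_numeral
    by (intro mult_left_mono norm_triangle_le add_mono) (auto simp: norm_mult)
  also have "\<dots> \<le> 4 * ((21/10) * (21/10) + (21/10) * (21/10) + (21/10) * (21/10))"
    using assms by (intro add_mono mult_mono mult_left_mono) auto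
  also have "\<dots> \<le> 54"
    by simp
  finally have *: "norm (4 * (w * w + w * w0 + w0 * w0)) \<le> 54" .
  have "4 * w ^ 3 - 4 * w0 ^ 3 = (4 * (w * w + w * w0 + w0 * w0)) * (w - w0)"
    by (simp add: algebra_simps eval_nat_numeral)
  then show ?thesis
    using mult_mono[OF * assms(3)] by (simp add: norm_mult)
qed

lemma norm_near:
  fixes w w0 :: complex
  assumes "norm (w - w0) \<le> e"
  shows "norm w \<le> norm w0 + e"
  using assms norm_triangle_ineq2[of w w0] by linarith

text \<open>On a ball of radius 1/10000 the derivative varies by at most \<open>54 / 10000\<close>,
  which is below 1/100.\<close>

lemma quartic_local:
  fixes w0 c :: complex
  assumes w0: "norm w0 \<le> 2" "mu > 0" "mu + 1/100 \<le> norm (4 * w0 ^ 3)"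
  shows "x \<in> cball w0 (1/10000) \<Longrightarrow> y \<in> cball w0 (1/10000) \<Longrightarrow> mu * norm (x - y) \<le> norm (x ^ 4 - y ^ 4)"
    and "t \<in> cball (w0 ^ 4) (mu / 10000) \<Longrightarrow> \<exists>w\<in>cball w0 (1/10000). w ^ 4 = t"
proof -
  have d: "((\<lambda>w. w ^ 4) has_field_derivative 4 * w ^ 3) (at w)" for w :: complex
    by (rule derivative_eq_intros refl | simp)+
  have k: "norm (4 * w ^ 3 - 4 * w0 ^ 3) \<le> 1/100" if "w \<in> cball w0 (1/10000)" for w
    using quartic_deriv_close[of w0 w "1/10000"] that w0 norm_near[of w w0 "1/10000"]
    by (auto simp: dist_norm norm_minus_commute)
  note * = nearly_constant_derivative[of w0 "1/10000", OF d k w0(2,3)]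
  show "x \<in> cball w0 (1/10000) \<Longrightarrow> y \<in> cball w0 (1/10000) \<Longrightarrow> mu * norm (x - y) \<le> norm (x ^ 4 - y ^ 4)"
    by (rule *(1)) auto
  show "t \<in> cball (w0 ^ 4) (mu / 10000) \<Longrightarrow> \<exists>w\<in>cball w0 (1/10000). w ^ 4 = t"
    using *(2) by simp
qed

text \<open>The bound 20000 on the variation rate of the base derivative calls for the smaller
  radius \<open>1/10^6\<close>; the variation is then at most 1/50.\<close>

lemma base_map_local:
  assumes z0: "norm z0 \<le> 101/100" "mu > 0" "mu + 1/10 \<le> norm (base_deriv z0)"
  shows "x \<in> cball z0 (1/10^6) \<Longrightarrow> y \<in> cball z0 (1/10^6) \<Longrightarrow>
      mu * norm (x - y) \<le> norm (base_map x - base_map y)"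
    and "t \<in> cball (base_map z0) (mu / 10^6) \<Longrightarrow> \<exists>z\<in>cball z0 (1/10^6). base_map z = t"
proof -
  have k: "norm (base_deriv z - base_deriv z0) \<le> 1/10" if "z \<in> cball z0 (1/10^6)" for z
    using base_deriv_close[of z0 z "1/10^6"] that z0 norm_near[of z z0 "1/10^6"]
    by (auto simp: dist_norm norm_minus_commute)
  note * = nearly_constant_derivative[of z0 "1/10^6", OF base_map_has_field_derivative k z0(2,3)]
  show "x \<in> cball z0 (1/10^6) \<Longrightarrow> y \<in> cball z0 (1/10^6) \<Longrightarrow>
      mu * norm (x - y) \<le> norm (base_map x - base_map y)"
    by (rule *(1)) auto
  show "t \<in> cball (base_map z0) (mu / 10^6) \<Longrightarrow> \<exists>z\<in>cball z0 (1/10^6). base_map z = t"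
    using *(2) by simp
qed

text \<open>The triangular form lets \<open>skew (z, w) = s\<close> be solved first for
  \<open>z\<close> and then for \<open>w\<close>. The change of offset caused by \<open>z\<close>
  moves the target of \<open>w ^ 4\<close> by at most \<open>10 / 10^6\<close> in total, well within
  the radius 2/10000 covered by the longer fibre side of \<open>B\<close>.\<close>

lemma expanding_region_charts:
  assumes y: "y \<in> expanding_region"
  shows "expanding_chart skew (3/2) (1/10^6) y"
proof -
  define B where "B = cball (fst y) (1/10^6) \<times> cball (snd y) (1/10000)"
  have y': "norm (fst y) \<le> 101/100" "norm (snd y) \<le> 2" "norm (base_deriv (fst y)) \<ge> 19/10"
      "norm (4 * snd y ^ 3) \<ge> 204/100"
    using y by (cases rule: expanding_region_cases;
        use norm_near_1[of "fst y" "1/100"] base_deriv_near_1[of "fst y"] base_deriv_near_0[of "fst y"]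
          norm_cube_ge[of "snd y"] in simp; fail)+
  have square_diff: "4 * s\<^sup>2 - 4 * t\<^sup>2 = 4 * (s + t) * (s - t)" for s t :: complex
    by (simp add: algebra_simps power2_eq_square)
  have "cball (skew y) (1/10^6) \<subseteq> skew ` B"
  proof
    fix s assume "s \<in> cball (skew y) (1/10^6)"
    then have s: "norm (s - skew y) \<le> 1/10^6"
      by (simp add: dist_norm norm_minus_commute)
    have s1: "norm (fst s - base_map (fst y)) \<le> 1/10^6"
      using norm_fst_le[of "fst (s - skew y)" "snd (s - skew y)"] s unfolding prod.collapse by simp
    have s2: "norm (snd s - (snd y ^ 4 + (4 * (fst y)\<^sup>2 - 4))) \<le> 1/10^6"
      using norm_snd_le[of "snd (s - skew y)" "fst (s - skew y)"] s unfolding prod.collapse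
      by (simp add: skew_def)
    obtain z where z: "z \<in> cball (fst y) (1/10^6)" "base_map z = fst s"
      using base_map_local(2)[OF y'(1), of "17/10" "fst s"] y'(3) s1
      by (auto simp: dist_norm norm_minus_commute)
    have zy: "norm (z - fst y) \<le> 1/10^6"
      using z by (simp add: dist_norm norm_minus_commute)
    have "norm (z + fst y) \<le> 21/10"
      using norm_near[OF zy] norm_triangle_ineq[of z "fst y"] y'(1) by simp
    then have "norm (4 * z\<^sup>2 - 4 * (fst y)\<^sup>2) \<le> 9 * (1/10^6)"
      unfolding square_diff norm_mult using zy by (intro mult_mono) auto
    moreover have "norm (s2 - a) \<le> u \<Longrightarrow> norm (b - c) \<le> v \<Longrightarrow> norm (s2 - (a - c + b)) \<le> u + v"
      for s2 a b c :: complex and u v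
      using norm_triangle_ineq4[of "s2 - a" "b - c"] by (simp add: algebra_simps)
    from this[OF s2 calculation]
    have "norm (snd s - (4 * z\<^sup>2 - 4) - snd y ^ 4) \<le> 10 / 10^6"
      by (simp add: algebra_simps)
    then obtain w where w: "w \<in> cball (snd y) (1/10000)" "w ^ 4 = snd s - (4 * z\<^sup>2 - 4)"
      using quartic_local(2)[OF y'(2), of 2 "snd s - (4 * z\<^sup>2 - 4)"] y'(4)
      by (auto simp: dist_norm norm_minus_commute)
    show "s \<in> skew ` B"
    proof (rule image_eqI)
      show "s = skew (z, w)"
        using z w by (simp add: skew_def prod_eq_iff)
      show "(z, w) \<in> B"
        using z w by (simp add: B_def)
    qed
  qed
  moreover have "(3/2) * norm (s - t) \<le> norm (skew s - skew t)" if "s \<in> B" "t \<in> B" for s t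
  proof (rule norm_pair_expand)
    have st: "fst s \<in> cball (fst y) (1/10^6)" "fst t \<in> cball (fst y) (1/10^6)"
      "snd s \<in> cball (snd y) (1/10000)" "snd t \<in> cball (snd y) (1/10000)"
      using that by (auto simp: B_def)
    then have n: "norm (fst s) \<le> norm (fst y) + 1/10^6" "norm (fst t) \<le> norm (fst y) + 1/10^6"
      by (auto intro!: norm_near simp: dist_norm norm_minus_commute)
    have "norm (snd s ^ 4 - snd t ^ 4) \<le> norm (snd (skew s - skew t)) + norm (4 * (fst s)\<^sup>2 - 4 * (fst t)\<^sup>2)"
      using norm_triangle_ineq4[of "snd (skew s - skew t)" "4 * (fst s)\<^sup>2 - 4 * (fst t)\<^sup>2"]
      by (simp add: skew_def algebra_simps)
    also have "norm (4 * (fst s)\<^sup>2 - 4 * (fst t)\<^sup>2) = 4 * norm (fst s + fst t) * norm (fst s - fst t)"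
      unfolding square_diff norm_mult by simp
    finally have 2: "norm (snd s ^ 4 - snd t ^ 4) \<le>
        norm (snd (skew s - skew t)) + 4 * norm (fst s + fst t) * norm (fst s - fst t)" .
    show "9 / 4 * ((norm (fst (s - t)))\<^sup>2 + (norm (snd (s - t)))\<^sup>2) \<le>
        (norm (fst (skew s - skew t)))\<^sup>2 + (norm (snd (skew s - skew t)))\<^sup>2"
      using y
    proof (cases rule: expanding_region_cases)
      case near_1
      have "norm (fst s + fst t) \<le> 9/4"
        using n norm_triangle_ineq[of "fst s" "fst t"] y'(1) by simp
      then have "4 * norm (fst s + fst t) * norm (fst s - fst t) \<le> 9 * norm (fst s - fst t)"
        by (intro mult_right_mono) auto
      moreover have "2 * norm (snd s - snd t) \<le> norm (snd s ^ 4 - snd t ^ 4)"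
        using y' st by (intro quartic_local(1)[of "snd y"]) auto
      moreover have "800 * norm (fst s - fst t) \<le> norm (base_map (fst s) - base_map (fst t))"
        using y' st base_deriv_near_1[OF near_1(1)] by (intro base_map_local(1)[of "fst y"]) auto
      ultimately show ?thesis
        using 2 by (intro triangular_expansion_near_1) auto
    next
      case near_0
      have "norm (fst s + fst t) \<le> 11/40"
        using n norm_triangle_ineq[of "fst s" "fst t"] near_0 by simp
      then have "4 * norm (fst s + fst t) * norm (fst s - fst t) \<le> (11/10) * norm (fst s - fst t)"
        by (intro mult_right_mono) auto
      moreover have "5 * norm (snd s - snd t) \<le> norm (snd s ^ 4 - snd t ^ 4)"
        using y' st norm_cube_ge(2)[OF near_0(3)] by (intro quartic_local(1)[of "snd y"]) auto
      moreover have "(17/10) * norm (fst s - fst t) \<le> norm (base_map (fst s) - base_map (fst t))"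
        using y' st by (intro base_map_local(1)[of "fst y"]) auto
      ultimately show ?thesis
        using 2 by (intro triangular_expansion_near_0) auto
    qed
  qed
  moreover have "y \<in> B"
    by (simp add: B_def mem_Times_iff)
  ultimately show ?thesis
    unfolding expanding_chart_def by (intro exI[of _ B]) (auto simp: dist_norm)
qed

text \<open>Over \<open>z = 0\<close> the base direction contracts, so shadowing there uses the
  one-dimensional fibre map alone.\<close>

lemma fiber_0_charts:
  fixes w :: complex
  assumes w: "8/10 \<le> norm w" "norm w \<le> 2"
  shows "expanding_chart (\<lambda>w. w ^ 4 - 4) (3/2) (1/10^6) w"
proof -
  have *: "norm (4 * w ^ 3) \<ge> 204/100"
    by (rule norm_cube_ge(1)[OF w(1)])
  have "\<exists>u\<in>cball w (1/10000). u ^ 4 = s + 4" if "s \<in> cball (w ^ 4 - 4) (1/10^6)" for s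
    using that w * by (intro quartic_local(2)[of _ 2]) (auto simp: dist_norm algebra_simps)
  then have "cball (w ^ 4 - 4) (1/10^6) \<subseteq> (\<lambda>w. w ^ 4 - 4) ` cball w (1/10000)"
    by (force simp: image_iff)
  moreover have "(3/2) * dist s t \<le> dist (s ^ 4 - 4) (t ^ 4 - 4)"
    if "s \<in> cball w (1/10000)" "t \<in> cball w (1/10000)" for s t
    using quartic_local(1)[of w "3/2" s t] that w * by (simp add: dist_norm)
  ultimately show ?thesis
    unfolding expanding_chart_def by (intro exI[of _ "cball w (1/10000)"]) auto
qed

section \<open>Closing nonwandering orbits\<close>

lemma funpow_split:
  assumes "j \<le> n"
  shows "(f ^^ n) x = (f ^^ (n - j)) ((f ^^ j) x)"
proof -
  have "(f ^^ (n - j)) ((f ^^ j) x) = ((f ^^ (n - j)) \<circ> (f ^^ j)) x"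
    by (rule comp_apply[symmetric])
  then show ?thesis
    using assms by (simp only: funpow_add[symmetric] le_add_diff_inverse2)
qed

lemma not_in_trap_before:
  assumes "(skew ^^ n) x \<notin> trap s" "j \<le> n" "s = 0 \<or> 1/2 \<le> s \<and> s \<le> 9/10"
  shows "(skew ^^ j) x \<notin> trap s"
proof
  assume "(skew ^^ j) x \<in> trap s"
  from skew_trap_iterate[OF assms(3) this, of "n - j"] show False
    using assms(1) funpow_split[OF assms(2), of skew x] by simp
qed

lemma base_map_iterate_small:
  assumes "norm z \<le> e" "e \<le> 29/1000"
  shows "norm ((base_map ^^ n) z) \<le> e"
proof (induction n)
  case (Suc n)
  then show ?case
    using base_map_contracts_at_0[of "(base_map ^^ n) z"] assms(2)
      norm_ge_zero[of "(base_map ^^ n) z"] unfolding funpow.simps comp_apply by linarith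
qed (use assms in auto)

lemma base_map_iterate_small_before:
  assumes "\<not> norm ((base_map ^^ n) z) \<le> e" "e \<le> 29/1000" "j \<le> n"
  shows "\<not> norm ((base_map ^^ j) z) \<le> e"
  using base_map_iterate_small[of "(base_map ^^ j) z" e "n - j"] assms
    funpow_split[OF assms(3), of base_map z] by auto

text \<open>A returning orbit is a closed pseudo-orbit with one jump. The conditions in
  \<open>U\<close> exclude the traps and the contracting disc at the return time, hence at all
  earlier times, so the orbit runs in the expanding region.\<close>

lemma periodic_near_nonwandering:
  assumes x: "x \<in> nonwandering skew" "x \<noteq> (1, 0)" "fst x \<noteq> 0" and e: "e > 0"
  shows "\<exists>p\<in>periodic_points skew. dist p x < e"
proof -
  \<comment> \<open>The jump is at most \<open>2 * d\<close>, so shadowing moves \<open>y\<close> by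
    at most \<open>4 * d\<close> and ends within \<open>5 * d < e\<close> of \<open>x\<close>; the
    chart radius requires \<open>3 * (2 * d) <= 1/10^6\<close>.\<close>
  define d where "d = min (e / 10) (1/10^7)"
  have d: "d > 0" "d \<le> e / 10" "d \<le> 1/10^7"
    using e by (auto simp: d_def)
  define U where "U = ball x d \<inter> {y. norm (fst (y::complex\<times>complex)) < 101/100 \<and> 28/1000 < norm (fst y) \<and>
    8/10 < norm (snd y) \<and> norm (snd y) < 2}"
  have "open U"
    unfolding U_def by (intro open_Int open_ball open_Collect_conj open_Collect_less continuous_intros)
  moreover have "\<not> norm (fst x) < 29/1000" "\<not> norm (snd x) < 9/10"
    using nonwandering_skew_fst_small[of x] nonwandering_skew_snd_small[of x] x by auto
  then have "x \<in> U"
    using nonwandering_skew_fst(1)[OF x(1)] nonwandering_skew_snd_less[OF x(1)] d by (auto simp: U_def)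
  ultimately obtain y n where n: "n \<ge> 1" "y \<in> U" "(skew ^^ n) y \<in> U"
    by (rule nonwanderingE[OF x(1)])
  have nt: "(skew ^^ n) y \<notin> trap (8/10)" "(skew ^^ n) y \<notin> trap 0"
    using n by (auto simp: U_def trap_def)
  have ns: "\<not> norm ((base_map ^^ n) (fst y)) \<le> 28/1000"
    using n by (auto simp: U_def fst_skew_iterate)
  have reg: "(skew ^^ j) y \<in> expanding_region" if "j < n" for j
  proof (rule expanding_regionI)
    show "(skew ^^ j) y \<notin> trap (8/10)" "skew ((skew ^^ j) y) \<notin> trap 0"
      using not_in_trap_before[OF nt(1), of j] not_in_trap_before[OF nt(2), of "Suc j"] that by auto
    show "28/1000 \<le> norm (fst ((skew ^^ j) y))"
      using base_map_iterate_small_before[OF ns, of j] that by (simp add: fst_skew_iterate)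
  qed
  define Y where "Y j = (if j < n then (skew ^^ j) y else y)" for j
  have jump: "dist (skew (Y j)) (Y (Suc j)) \<le> 2 * d" if "j < n" for j
  proof (cases "Suc j < n")
    case True
    then show ?thesis using that d by (simp add: Y_def)
  next
    case False
    then have "n = Suc j"
      using that by simp
    then have "skew (Y j) = (skew ^^ n) y" "Y (Suc j) = y"
      by (simp_all add: Y_def)
    then show ?thesis
      using n(2,3) dist_triangle3[of "(skew ^^ n) y" y x] by (auto simp: U_def)
  qed
  have chart: "expanding_chart skew (3/2) (1/10^6) (Y j)" if "j < n" for j
    using expanding_region_charts[OF reg[OF that]] that by (simp add: Y_def)
  have "\<exists>p. (skew ^^ n) p = p \<and> dist p (Y 0) \<le> 2 * d / (3/2 - 1)"
    by (rule periodic_shadowing[where f=skew and y=Y, OF _ _ _ chart jump]) (use d n(1) in \<open>simp_all add: Y_def\<close>)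
  then obtain p where p: "(skew ^^ n) p = p" "dist p (Y 0) \<le> 2 * d / (3/2 - 1)"
    by blast
  have "dist p x \<le> dist p y + dist y x"
    by (rule dist_triangle)
  also have "\<dots> < 4 * d + d"
    using p n by (auto simp: Y_def U_def dist_commute)
  finally have "dist p x < e"
    using d by simp
  moreover have "p \<in> periodic_points skew"
    using p(1) n(1) unfolding periodic_points_def by blast
  ultimately show ?thesis
    by blast
qed

lemma skew_iterate_fiber_0: "(skew ^^ n) (0, w) = (0, ((\<lambda>w. w ^ 4 - 4) ^^ n) w)"
  by (induction n) (auto simp: skew_def)

text \<open>The returning orbit need not lie over 0, but its base points stay within
  \<open>d\<close> of 0. Its \<open>w\<close>-coordinates then form a pseudo-orbit of
  \<open>w ^ 4 - 4\<close>, which is shadowed inside the invariant fibre.\<close>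

lemma periodic_near_nonwandering_fiber_0:
  assumes x: "x \<in> nonwandering skew" "fst x = 0" and e: "e > 0"
  shows "\<exists>p\<in>periodic_points skew. dist p x < e"
proof -
  define d where "d = min (e / 10) (1/10^7)"
  have d: "d > 0" "d \<le> e / 10" "d \<le> 1/10^7"
    using e by (auto simp: d_def)
  define U where "U = ball x d \<inter> {y. 8/10 < norm (snd (y::complex\<times>complex)) \<and> norm (snd y) < 2}"
  have "open U"
    unfolding U_def by (intro open_Int open_ball open_Collect_conj open_Collect_less continuous_intros)
  moreover have "x \<in> U"
    using nonwandering_fiber_0[OF x] nonwandering_skew_snd_less[OF x(1)] d by (auto simp: U_def)
  ultimately obtain y n where n: "n \<ge> 1" "y \<in> U" "(skew ^^ n) y \<in> U"
    by (rule nonwanderingE[OF x(1)])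
  have "dist (fst x) (fst y) \<le> d"
    using n dist_fst_le[of x y] by (auto simp: U_def)
  then have fst_y: "norm (fst y) \<le> d"
    using x by simp
  have z: "norm (fst ((skew ^^ j) y)) \<le> d" for j
    unfolding fst_skew_iterate using fst_y d by (intro base_map_iterate_small) auto
  have nt: "(skew ^^ n) y \<notin> trap (8/10)"
    using n z[of n] d by (auto simp: U_def trap_def)
  have w: "8/10 \<le> norm (snd ((skew ^^ j) y))" "norm (snd ((skew ^^ j) y)) \<le> 2" if "j \<le> n" for j
    using not_in_trap_before[OF nt that] by (auto simp: not_in_trap)
  define W where "W j = snd (if j < n then (skew ^^ j) y else y)" for j
  \<comment> \<open>The error is \<open>4 * norm z ^ 2\<close> for the current base point
    \<open>z\<close>, quadratic in a distance of at most \<open>d\<close>.\<close>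
  have small: "dist (snd ((skew ^^ j) y) ^ 4 - 4) (snd ((skew ^^ Suc j) y)) \<le> d" for j
  proof -
    have "norm (fst ((skew ^^ j) y)) ^ 2 \<le> d * (1/10)"
      unfolding power2_eq_square using z[of j] d by (intro mult_mono) auto
    then show ?thesis
      using d by (simp add: skew_def dist_norm norm_mult norm_power)
  qed
  have jump: "dist (W j ^ 4 - 4) (W (Suc j)) \<le> 3 * d" if "j < n" for j
  proof (cases "Suc j < n")
    case True
    then show ?thesis using that d small[of j] by (simp add: W_def)
  next
    case False
    then have j: "Suc j = n"
      using that by simp
    have "dist (snd ((skew ^^ Suc j) y)) (snd y) \<le> 2 * d"
      using n(2,3) dist_triangle3[of "(skew ^^ n) y" y x] dist_snd_le[of "(skew ^^ n) y" y]
      unfolding j by (auto simp: U_def)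
    then show ?thesis
      using that j dist_triangle[of "W j ^ 4 - 4" "snd y" "snd ((skew ^^ Suc j) y)"] small[of j]
      by (simp add: W_def)
  qed
  have chart: "expanding_chart (\<lambda>w. w ^ 4 - 4) (3/2) (1/10^6) (W j)" if "j < n" for j
    using fiber_0_charts w[of j] that by (simp add: W_def)
  have "\<exists>p. ((\<lambda>w. w ^ 4 - 4) ^^ n) p = p \<and> dist p (W 0) \<le> 3 * d / (3/2 - 1)"
    by (rule periodic_shadowing[where f="\<lambda>w. w ^ 4 - 4" and y=W, OF _ _ _ chart jump]) (use d n(1) in \<open>simp_all add: W_def\<close>)
  then obtain p where p: "((\<lambda>w. w ^ 4 - 4) ^^ n) p = p" "dist p (W 0) \<le> 3 * d / (3/2 - 1)"
    by blast
  have "dist (0, p) x = dist p (snd x)"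
    using x(2) by (simp add: dist_prod_def)
  also have "\<dots> \<le> dist p (snd y) + dist (snd y) (snd x)"
    by (rule dist_triangle)
  also have "\<dots> < 6 * d + d"
    using p n dist_snd_le[of y x] by (auto simp: W_def U_def dist_commute)
  finally have "dist (0, p) x < e"
    using d by simp
  moreover have "(0, p) \<in> periodic_points skew"
    using p(1) n(1) unfolding periodic_points_def
    by (intro CollectI exI[of _ n]) (simp add: skew_iterate_fiber_0)
  ultimately show ?thesis
    by blast
qed

lemma axiom_A_skew: "axiom_A skew"
  unfolding axiom_A_def
proof (intro conjI compact_nonwandering_skew hyperbolic_skew subsetI)
  fix x assume x: "x \<in> nonwandering skew"
  show "x \<in> closure (periodic_points skew)"
    unfolding closure_approachable
  proof (intro allI impI)
    fix e :: real assume e: "e > 0"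
    consider "x = (1, 0)" | "x \<noteq> (1, 0)" "fst x \<noteq> 0" | "fst x = 0"
      by auto
    then show "\<exists>p\<in>periodic_points skew. dist p x < e"
    proof cases
      case 1
      have "(1, 0) \<in> periodic_points skew"
        unfolding periodic_points_def by (auto intro!: exI[of _ 1])
      then show ?thesis
        using e 1 by force
    qed (use periodic_near_nonwandering periodic_near_nonwandering_fiber_0 x e in auto)
  qed
qed


section \<open>Julia sets and accumulation sets\<close>

definition base_poly :: "complex poly" where
  "base_poly = [:0, 0, 0, 1001, - 1000:]"

definition fiber_family :: "complex poly poly" where
  "fiber_family = [:[:-4, 0, 4:], 0, 0, 0, 1:]"

lemma poly_base_poly: "poly base_poly = base_map"
  by (auto simp: base_poly_def base_map_def fun_eq_iff algebra_simps eval_nat_numeral)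

lemma fiber_poly_fiber_family: "fiber_poly fiber_family z = [:4 * z\<^sup>2 - 4, 0, 0, 0, 1:]"
  by (simp add: fiber_poly_def fiber_family_def map_poly_pCons algebra_simps power2_eq_square)

lemma skew_map_eq: "skew_map base_poly fiber_family = skew"
  by (auto simp: skew_map_def skew_def poly_base_poly fiber_poly_fiber_family fun_eq_iff
      algebra_simps eval_nat_numeral)

lemma polynomial_skew_product_skew: "polynomial_skew_product 4 base_poly fiber_family"
  by (simp add: polynomial_skew_product_def fiber_poly_fiber_family base_poly_def)

text \<open>Leaving this disc forces exponential growth, so a bounded orbit never leaves it.\<close>

lemma filled_julia_iff: "z \<in> filled_julia base_poly \<longleftrightarrow> (\<forall>n. norm ((base_map ^^ n) z) \<le> 101/100)"
proof
  assume "z \<in> filled_julia base_poly"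
  then obtain c where c: "norm ((base_map ^^ n) z) \<le> c" for n
    by (auto simp: filled_julia_def poly_base_poly bounded_iff)
  show "\<forall>n. norm ((base_map ^^ n) z) \<le> 101/100"
  proof (rule ccontr)
    assume "\<not> ?thesis"
    then obtain n where n: "norm ((base_map ^^ n) z) > 101/100"
      by (auto simp: not_le)
    have "2 ^ k * norm ((base_map ^^ n) z) \<le> c" for k
    proof -
      have "2 ^ k * norm ((base_map ^^ n) z) \<le> norm ((base_map ^^ k) ((base_map ^^ n) z))"
        using n by (intro base_map_iterate_escape) auto
      also have "(base_map ^^ k) ((base_map ^^ n) z) = (base_map ^^ (n + k)) z"
        using funpow_split[of n "n + k" base_map z] by simp
      finally show ?thesis
        using c order_trans by blast
    qed
    from exponential_bound_imp_le_0[OF this] n show False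
      by simp
  qed
next
  assume "\<forall>n. norm ((base_map ^^ n) z) \<le> 101/100"
  then show "z \<in> filled_julia base_poly"
    unfolding filled_julia_def poly_base_poly bounded_iff by blast
qed

lemma filled_julia_norm: "z \<in> filled_julia base_poly \<Longrightarrow> norm z \<le> 101/100"
  unfolding filled_julia_iff by (drule spec[of _ 0]) simp

lemma filled_julia_base_map:
  "base_map z \<in> filled_julia base_poly \<longleftrightarrow> z \<in> filled_julia base_poly"
proof
  assume *: "base_map z \<in> filled_julia base_poly"
  show "z \<in> filled_julia base_poly"
    unfolding filled_julia_iff
  proof
    fix n
    have z: "norm ((base_map ^^ n) (base_map z)) \<le> 101/100" for n
      using * by (simp add: filled_julia_iff)
    show "norm ((base_map ^^ n) z) \<le> 101/100"
    proof (cases n)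
      \<comment> \<open>Time 0 is not seen by the orbit of \<open>base_map z\<close>; a point
        outside the disc would have its image outside too.\<close>
      case 0
      then show ?thesis
        using base_map_escape[of z] z[of 0] by (simp, linarith)
    next
      case (Suc m)
      then show ?thesis
        using z[of m] by (simp add: funpow_swap1)
    qed
  qed
next
  assume *: "z \<in> filled_julia base_poly"
  have "norm ((base_map ^^ n) (base_map z)) \<le> 101/100" for n
    using *[unfolded filled_julia_iff, rule_format, of "Suc n"] by (simp add: funpow_swap1)
  then show "base_map z \<in> filled_julia base_poly"
    by (simp add: filled_julia_iff)
qed

lemma filled_julia_iterate:
  "z \<in> filled_julia base_poly \<Longrightarrow> (base_map ^^ n) z \<in> filled_julia base_poly"
  by (induction n) (auto simp: filled_julia_base_map)

lemma filled_julia_cases: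
  "z \<in> filled_julia base_poly \<Longrightarrow> norm z \<le> 13/100 \<or> norm (z - 1) \<le> 1/100"
  using base_map_bounded_cases[of z] filled_julia_norm[of "base_map z"]
  by (simp add: filled_julia_base_map)

lemma continuous_on_base_map_iterate: "continuous_on A (base_map ^^ n)"
  by (induction n) (auto intro!: continuous_intros simp: o_def id_def)

lemma closed_filled_julia: "closed (filled_julia base_poly)"
proof -
  have "filled_julia base_poly = (\<Inter>n. {z. norm ((base_map ^^ n) z) \<le> 101/100})"
    by (auto simp: filled_julia_iff)
  also have "closed \<dots>"
    by (intro closed_INT ballI closed_Collect_le continuous_intros continuous_on_base_map_iterate)
  finally show ?thesis .
qed

lemma julia_eq: "julia base_poly = filled_julia base_poly - interior (filled_julia base_poly)"
  using closed_filled_julia by (simp add: julia_def frontier_def closure_closed)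

lemma connected_filled_julia_cases:
  assumes S: "connected S" "S \<subseteq> filled_julia base_poly"
  shows "S \<subseteq> cball 0 (13/100) \<or> S \<subseteq> cball 1 (1/100)"
proof -
  have "cball 0 (13/100) \<inter> cball (1::complex) (1/100) = {}"
  proof (intro equals0I)
    fix z :: complex
    assume "z \<in> cball 0 (13/100) \<inter> cball 1 (1/100)"
    then show False
      using norm_near_1[of z "1/100"] by (auto simp: dist_norm norm_minus_commute)
  qed
  moreover have "S \<subseteq> cball 0 (13/100) \<union> cball 1 (1/100)"
    using S(2) filled_julia_cases by (force simp: dist_norm norm_minus_commute)
  ultimately have "cball 0 (13/100) \<inter> S = {} \<or> cball 1 (1/100) \<inter> S = {}"
    using connected_closedD[OF S(1), of "cball 0 (13/100)" "cball 1 (1/100)"] by auto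
  then show ?thesis
    using \<open>S \<subseteq> cball 0 (13/100) \<union> cball 1 (1/100)\<close> by blast
qed

lemma connected_image_iterate:
  assumes "connected S" "S \<subseteq> filled_julia base_poly"
  shows "connected ((base_map ^^ n) ` S)" "(base_map ^^ n) ` S \<subseteq> filled_julia base_poly"
  using assms filled_julia_iterate
  by (auto intro!: connected_continuous_image continuous_on_base_map_iterate)

lemma stays_near_1_imp_eq_1:
  assumes "\<And>n. norm ((base_map ^^ n) z - 1) \<le> 1/100"
  shows "z = 1"
proof -
  have *: "2 ^ n * norm (z - 1) \<le> norm ((base_map ^^ n) z - 1)" for n
  proof (induction n)
    case (Suc n)
    then show ?case
      using base_map_expands_at_1[OF assms[of n]] by simp
  qed auto
  have "2 ^ n * norm (z - 1) \<le> 1/100" for n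
    using *[of n] assms[of n] by linarith
  from exponential_bound_imp_le_0[OF this] show ?thesis
    by simp
qed

lemma base_map_iterate_1 [simp]: "(base_map ^^ n) 1 = 1"
  by (induction n) auto

text \<open>Each image of \<open>S\<close> under an iterate is connected and contains the fixed
  point 1, so it stays in the small disc around 1, where expansion leaves only 1 itself.\<close>

lemma connected_filled_julia_1:
  assumes S: "connected S" "S \<subseteq> filled_julia base_poly" "1 \<in> S"
  shows "S = {1}"
proof -
  have "z = 1" if "z \<in> S" for z
  proof (rule stays_near_1_imp_eq_1)
    fix n
    have "1 \<in> (base_map ^^ n) ` S"
      using S(3) by (intro image_eqI[of _ _ 1]) auto
    moreover have "(1::complex) \<notin> cball 0 (13/100)"
      by simp
    ultimately have "(base_map ^^ n) ` S \<subseteq> cball 1 (1/100)"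
      using connected_filled_julia_cases[OF connected_image_iterate[OF S(1,2), of n]] by blast
    then have "(base_map ^^ n) z \<in> cball 1 (1/100)"
      using that by blast
    then show "norm ((base_map ^^ n) z - 1) \<le> 1/100"
      by (simp add: dist_norm norm_minus_commute)
  qed
  then show ?thesis
    using S(3) by blast
qed

text \<open>Were 1 an interior point, a ball around it would be a connected subset with more than
  one point.\<close>

lemma one_in_julia: "1 \<in> julia base_poly"
proof -
  have "1 \<in> filled_julia base_poly"
    by (simp add: filled_julia_iff)
  moreover have "1 \<notin> interior (filled_julia base_poly)"
  proof
    assume "1 \<in> interior (filled_julia base_poly)"
    then obtain e where e: "e > 0" "ball 1 e \<subseteq> filled_julia base_poly"
      by (auto simp: mem_interior)
    have "ball 1 e = {1::complex}"
      using e by (intro connected_filled_julia_1) auto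
    moreover have "1 + of_real (e / 2) \<in> ball (1::complex) e"
      using e(1) by (simp add: dist_norm)
    ultimately show False
      using e(1) by auto
  qed
  ultimately show ?thesis
    by (simp add: julia_eq)
qed

text \<open>The segment from 0 to 1/2 starts inside the filled Julia set and ends outside, so it
  meets the frontier, at a point too far from 1 to lie in the other piece.\<close>

lemma julia_near_0: "\<exists>z\<in>julia base_poly. norm z \<le> 13/100"
proof -
  have "0 \<in> filled_julia base_poly"
    using base_map_iterate_small[of 0 0] by (simp add: filled_julia_iff)
  moreover have "1/2 \<notin> filled_julia base_poly"
    using filled_julia_cases[of "1/2"] by (auto simp: norm_divide)
  ultimately have "closed_segment 0 (1/2) \<inter> frontier (filled_julia base_poly) \<noteq> {}"
    by (intro connected_Int_frontier) (auto simp: disjoint_iff)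
  then obtain z where z: "z \<in> closed_segment 0 (1/2)" "z \<in> julia base_poly"
    by (auto simp: julia_def)
  have "norm z \<le> 1/2"
    using z(1) segment_bound1[of z 0 "1/2"] by (simp add: norm_divide)
  then have "norm z \<le> 13/100"
    using filled_julia_cases[of z] z(2) norm_near_1(1)[of z "1/100"] by (auto simp: julia_eq)
  then show ?thesis
    using z by blast
qed

lemma not_connected_julia: "\<not> connected (julia base_poly)"
proof
  assume "connected (julia base_poly)"
  then have "julia base_poly = {1}"
    using one_in_julia by (intro connected_filled_julia_1) (auto simp: julia_eq)
  then show False
    using julia_near_0 by auto
qed

text \<open>The plane without \<open>a\<close> is connected and meets both \<open>C\<close> and
  \<open>S\<close>, so it must meet the frontier of \<open>C\<close>.\<close>

lemma component_frontier_infinite: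
  fixes S :: "complex set"
  assumes C: "C \<in> components (- S)" and S: "closed S" "interior S \<noteq> {}"
  shows "\<not> frontier C \<subseteq> {a}"
proof
  assume a: "frontier C \<subseteq> {a}"
  have open_C: "open C" "C \<noteq> {}"
    using C S(1) open_components[of "- S" C] in_components_nonempty[OF C] by auto
  have infin: "\<exists>x\<in>U. x \<noteq> a" if "open U" "U \<noteq> {}" for U :: "complex set"
    using that not_open_singleton by (metis subset_singletonD subset_iff singleton_iff)
  have "C \<subseteq> - S"
    using C in_components_subset by blast
  moreover obtain x where "x \<in> C" "x \<noteq> a"
    using infin open_C by blast
  moreover obtain y where "y \<in> S" "y \<noteq> a"
    using infin[of "interior S"] S interior_subset by blast
  ultimately have "(- {a}) \<inter> frontier C \<noteq> {}"
    by (intro connected_Int_frontier connected_punctured_universe) (auto simp: DIM_complex)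
  then show False
    using a by blast
qed

text \<open>Let \<open>V\<close> be the component of 0 in the interior of the filled Julia set, and
  \<open>C\<close> the component of 2 in the complement of its closure. The frontier of
  \<open>C\<close> is connected, lies in the Julia set and is not a single point.\<close>

lemma not_totally_disconnected_julia: "\<not> totally_disconnected (julia base_poly)"
proof
  assume td: "totally_disconnected (julia base_poly)"
  define F where "F = filled_julia base_poly"
  have "ball 0 (29/1000) \<subseteq> F"
  proof
    fix z :: complex assume "z \<in> ball 0 (29/1000)"
    then have "norm ((base_map ^^ n) z) \<le> 29/1000" for n
      by (intro base_map_iterate_small) auto
    then have "norm ((base_map ^^ n) z) \<le> 101/100" for n
      by (rule order_trans) simp
    then show "z \<in> F"
      by (simp add: F_def filled_julia_iff)
  qed
  then have 0: "0 \<in> interior F"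
    by (intro interiorI[of "ball 0 (29/1000)"]) auto
  define V where "V = connected_component_set (interior F) 0"
  have V: "0 \<in> V" "open V" "connected V" "V \<subseteq> F"
    using 0 interior_subset connected_component_subset[of "interior F" 0]
    by (auto simp: V_def open_connected_component)
  define S where "S = closure V"
  have S: "S \<subseteq> F" "closed S" "connected S" "0 \<in> interior S"
    using V closed_filled_julia closure_subset[of V] closure_minimal[of V F]
    by (auto simp: S_def F_def intro: connected_imp_connected_closure interiorI)
  have "2 \<in> - S"
    using S(1) filled_julia_norm[of 2] by (auto simp: F_def)
  define C where "C = connected_component_set (- S) 2"
  have C: "C \<in> components (- S)"
    using \<open>2 \<in> - S\<close> by (auto simp: C_def components_def)
  have "frontier C \<subseteq> frontier S"
    using frontier_of_components_subset[OF C] by (simp add: frontier_complement)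
  also have "\<dots> \<subseteq> frontier V"
    unfolding S_def frontier_def using interior_mono[OF closure_subset, of V] by auto
  also have "\<dots> \<subseteq> frontier (interior F)"
    using 0 by (intro frontier_of_components_subset) (auto simp: V_def components_def)
  also have "\<dots> \<subseteq> frontier F"
    by (rule frontier_interior_subset)
  finally have "frontier C \<subseteq> julia base_poly"
    by (simp add: julia_def F_def)
  moreover have "connected (frontier C)"
    using C S(3) by (intro connected_frontier_component_complement) (auto simp: DIM_complex)
  ultimately obtain a where "frontier C \<subseteq> {a}"
    using td unfolding totally_disconnected_def by blast
  then show False
    using component_frontier_infinite[OF C S(2)] S(4) by blast
qed

text \<open>The derivative at 1 has modulus 997 and varies by at most 200, so the small disc covers
  radius \<open>700 * (1/100) = 7\<close>. This contains the whole filled Julia set, hence every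
  Julia point has a preimage near 1.\<close>

lemma base_map_branch_at_1:
  assumes "norm (t - 1) \<le> 7"
  shows "\<exists>z\<in>cball 1 (1/100). base_map z = t"
    and "x \<in> cball 1 (1/100) \<Longrightarrow> y \<in> cball 1 (1/100) \<Longrightarrow> norm (x - y) \<le> norm (base_map x - base_map y)"
proof -
  have k: "norm (base_deriv z - base_deriv 1) \<le> 200" if "z \<in> cball 1 (1/100)" for z
    using base_deriv_close[of 1 z "1/100"] that norm_near_1[of z "1/100"]
    by (auto simp: dist_norm norm_minus_commute)
  have c: "700 + 200 \<le> norm (base_deriv 1)"
    by (simp add: base_deriv_def)
  note * = nearly_constant_derivative[of 1 "1/100", OF base_map_has_field_derivative k _ c]
  show "\<exists>z\<in>cball 1 (1/100). base_map z = t"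
    using assms by (intro *(2)) (auto simp: dist_norm norm_minus_commute)
  show "norm (x - y) \<le> norm (base_map x - base_map y)" if "x \<in> cball 1 (1/100)" "y \<in> cball 1 (1/100)"
    using *(1)[OF _ _ _ that] norm_ge_zero[of "x - y"] by linarith
qed

text \<open>Points near \<open>base_map z\<close> outside the filled Julia set are pulled back by
  the distance-nonincreasing branch to such points near \<open>z\<close>, so \<open>z\<close> is not
  interior.\<close>

lemma julia_branch_at_1:
  assumes t: "base_map z \<in> julia base_poly" and z: "norm (z - 1) \<le> 1/100"
  shows "z \<in> julia base_poly"
proof -
  define F where "F = filled_julia base_poly"
  have "z \<notin> interior F"
  proof
    assume "z \<in> interior F"
    then obtain e where e: "e > 0" "ball z e \<subseteq> F"
      by (auto simp: mem_interior)
    have "base_map z \<in> frontier F"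
      using t by (simp add: julia_def F_def)
    \<comment> \<open>The bound 1 keeps \<open>t'\<close> inside the domain of the inverse branch,
      the bound \<open>e\<close> brings its preimage into the ball around \<open>z\<close>.\<close>
    then obtain t' where t': "t' \<notin> F" "dist (base_map z) t' < min e 1"
      using e(1) unfolding frontier_straddle by (metis min_less_iff_conj zero_less_one min_def)
    have "norm (base_map z) \<le> 101/100"
      using t filled_julia_norm by (auto simp: julia_eq)
    then have "norm (base_map z - 1) \<le> 3"
      using norm_triangle_ineq4[of "base_map z" 1] by simp
    then have "norm (t' - 1) \<le> 7"
      using t'(2) norm_triangle_ineq[of "t' - base_map z" "base_map z - 1"]
      by (simp add: dist_norm norm_minus_commute)
    then obtain z' where z': "z' \<in> cball 1 (1/100)" "base_map z' = t'"
      using base_map_branch_at_1(1) by blast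
    have "norm (z - z') \<le> norm (base_map z - base_map z')"
      using z z' \<open>norm (t' - 1) \<le> 7\<close>
      by (intro base_map_branch_at_1(2)) (auto simp: dist_norm norm_minus_commute)
    then have "z' \<in> ball z e"
      using t'(2) z'(2) by (simp add: dist_norm)
    then show False
      using e(2) t'(1) z'(2) filled_julia_base_map[of z'] by (auto simp: F_def)
  qed
  then show ?thesis
    using t by (auto simp: julia_eq F_def filled_julia_base_map)
qed

section \<open>Accumulation sets of the critical set\<close>

lemma crit_set_eq: "crit_set base_poly fiber_family = julia base_poly \<times> {0}"
  by (auto simp: crit_set_def fiber_poly_fiber_family pderiv_pCons)

lemma attracted_while_near_1:
  assumes "norm (snd x) \<le> 9/10" "\<And>j. j < n \<Longrightarrow> norm ((base_map ^^ j) (fst x) - 1) \<le> 1/100"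
  shows "norm (snd ((skew ^^ n) x)) \<le> 9/10"
  using assms(2)
proof (induction n)
  case (Suc n)
  then have "norm (snd ((skew ^^ n) x)) \<le> 9/10"
    by simp
  moreover from this have "norm (snd (skew ((skew ^^ n) x))) \<le>
      (73/100) * norm (snd ((skew ^^ n) x)) + 12 * (1/100)"
    using Suc(2)[of n] by (intro skew_attracted_near_1) (auto simp: fst_skew_iterate)
  ultimately show ?case
    by simp
qed (use assms in auto)

lemma acc_set_empty:
  assumes "\<And>c. \<exists>N. \<forall>n\<ge>N. \<forall>x\<in>X. c < norm (snd ((f ^^ n) x))"
  shows "acc_set f X = ({} :: (complex \<times> complex) set)"
proof (rule equals0I)
  fix a assume a: "a \<in> acc_set f X"
  obtain N where N: "\<forall>n\<ge>N. \<forall>x\<in>X. norm (snd a) + 1 < norm (snd ((f ^^ n) x))"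
    using assms by blast
  have "a \<in> closure (\<Union>n\<in>{N..}. (f ^^ n) ` X)"
    using a by (auto simp: acc_set_def)
  then obtain b where "b \<in> (\<Union>n\<in>{N..}. (f ^^ n) ` X)" "dist b a < 1"
    unfolding closure_approachable by (meson zero_less_one)
  then have "norm (snd a) + 1 < norm (snd b)" "dist (snd b) (snd a) < 1"
    using N dist_snd_le[of b a] by auto
  then show False
    using norm_triangle_sub[of "snd b" "snd a"] by (simp add: dist_norm)
qed

text \<open>Some point of \<open>S\<close> leaves the disc around 1, first at time \<open>j\<close>;
  by connectedness all of \<open>S\<close> moves to the disc around 0 at that same time. One more
  step throws every fibre coordinate past 2, and the escape is then uniform on
  \<open>S\<close>.\<close>

lemma acc_set_julia_empty:
  assumes S: "connected S" "S \<subseteq> julia base_poly" "1 \<notin> S"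
  shows "acc_set skew (S \<times> {0}) = {}"
proof (cases "S = {}")
  case True
  then show ?thesis by (simp add: acc_set_def)
next
  case False
  then obtain z where z: "z \<in> S" by blast
  have SF: "S \<subseteq> filled_julia base_poly"
    using S(2) by (auto simp: julia_eq)
  define Q where "Q n \<longleftrightarrow> \<not> norm ((base_map ^^ n) z - 1) \<le> 1/100" for n
  have "\<exists>n. Q n"
    using stays_near_1_imp_eq_1[of z] z S(3) unfolding Q_def by blast
  define j where "j = (LEAST n. Q n)"
  have j: "Q j" "\<And>i. i < j \<Longrightarrow> \<not> Q i"
    using LeastI_ex[OF \<open>\<exists>n. Q n\<close>] not_less_Least unfolding j_def by blast+
  note cases = connected_filled_julia_cases[OF connected_image_iterate[OF S(1) SF]]
  have near_0: "norm ((base_map ^^ j) x) \<le> 13/100" if "x \<in> S" for x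
  proof -
    have "(base_map ^^ j) z \<notin> cball 1 (1/100)"
      using j(1) by (simp add: Q_def dist_norm norm_minus_commute)
    then have "(base_map ^^ j) ` S \<subseteq> cball 0 (13/100)"
      using cases[of j] z by blast
    then show ?thesis
      using that by auto
  qed
  have near_1: "norm ((base_map ^^ i) x - 1) \<le> 1/100" if "x \<in> S" "i < j" for x i
  proof -
    have "norm ((base_map ^^ i) z - 1) \<le> 1/100"
      using j(2)[OF that(2)] by (simp add: Q_def)
    then have "(base_map ^^ i) z \<notin> cball 0 (13/100)"
      using norm_near_1(1)[of "(base_map ^^ i) z" "1/100"] by auto
    then have "(base_map ^^ i) ` S \<subseteq> cball 1 (1/100)"
      using cases[of i] z by blast
    then have "(base_map ^^ i) x \<in> cball 1 (1/100)"
      using that by blast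
    then show ?thesis
      by (simp add: dist_norm norm_minus_commute)
  qed
  have escape: "norm (snd ((skew ^^ (Suc j + k)) (x, 0))) \<ge> 2 ^ k * 2" if "x \<in> S" for x k
  proof -
    have "norm (snd ((skew ^^ j) (x, 0))) \<le> 9/10"
      using near_1[OF that] by (intro attracted_while_near_1) auto
    then have 2: "norm (snd ((skew ^^ Suc j) (x, 0))) \<ge> 2"
      using skew_escape_near_0[of "(skew ^^ j) (x, 0)"] near_0[OF that] by (simp add: fst_skew_iterate)
    have "norm ((base_map ^^ i) (fst ((skew ^^ Suc j) (x, 0)))) \<le> 101/100" for i
      unfolding fst_skew_iterate using that SF
      by (intro filled_julia_norm filled_julia_iterate) auto
    then have "2 ^ k * norm (snd ((skew ^^ Suc j) (x, 0))) \<le> norm (snd ((skew ^^ k) ((skew ^^ Suc j) (x, 0))))"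
      by (intro skew_iterate_escape 2) auto
    also have "(skew ^^ k) ((skew ^^ Suc j) (x, 0)) = (skew ^^ (Suc j + k)) (x, 0)"
      using funpow_split[of "Suc j" "Suc j + k" skew "(x, 0)"] by (simp del: funpow.simps)
    finally show ?thesis
      using mult_left_mono[OF 2, of "2 ^ k"] by (meson order_trans zero_le_numeral zero_le_power)
  qed
  show ?thesis
  proof (rule acc_set_empty)
    fix c :: real
    obtain k where k: "c < 2 ^ k"
      using real_arch_pow[of 2 c] by auto
    have "c < norm (snd ((skew ^^ n) (x, 0)))" if "n \<ge> Suc j + k" "x \<in> S" for n x
    proof -
      define i where "i = n - Suc j"
      have i: "n = Suc j + i" "i \<ge> k"
        using that(1) by (auto simp: i_def)
      have "(2::real) ^ k \<le> 2 ^ i" "(0::real) < 2 ^ i"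
        using i by (auto intro: power_increasing)
      then show ?thesis
        using escape[OF that(2), of i] k unfolding i(1) by linarith
    qed
    then show "\<exists>N. \<forall>n\<ge>N. \<forall>x\<in>S \<times> {0}. c < norm (snd ((skew ^^ n) x))"
      by (intro exI[of _ "Suc j + k"]) auto
  qed
qed

lemma acc_set_saddle: "acc_set skew {(1, 0)} = {(1, 0)}"
proof -
  have "(skew ^^ n) (1, 0) = (1, 0)" for n
    by (induction n) auto
  then have "(\<Union>n\<in>{N..}. (skew ^^ n) ` {(1, 0)}) = {(1, 0)}" for N :: nat
    by auto
  then show ?thesis
    by (simp add: acc_set_def)
qed

lemma acc_set_julia:
  assumes "connected S" "S \<subseteq> julia base_poly"
  shows "acc_set skew (S \<times> {0}) = (if 1 \<in> S then {(1, 0)} else {})"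
proof (cases "1 \<in> S")
  case True
  then have "S = {1}"
    using assms by (intro connected_filled_julia_1) (auto simp: julia_eq)
  then show ?thesis
    using acc_set_saddle by simp
qed (use acc_set_julia_empty assms in simp)

lemma acc_pt_skew: "acc_pt skew (julia base_poly \<times> {0}) = {(1, 0)}"
proof -
  have "acc_set skew {(z, 0)} = (if z = 1 then {(1, 0)} else {})" if "z \<in> julia base_poly" for z
    using acc_set_julia[of "{z}"] that by auto
  then have "(\<Union>x\<in>julia base_poly \<times> {0}. acc_set skew {x}) = {(1, 0)}"
    using one_in_julia by (auto split: if_splits)
  then show ?thesis
    by (simp add: acc_pt_def)
qed

lemma acc_cc_skew: "acc_cc skew (julia base_poly \<times> {0}) = {(1, 0)}"
proof -
  let ?X = "julia base_poly \<times> {0::complex}"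
  have *: "acc_set skew C = (if (1, 0) \<in> C then {(1, 0)} else {})" if "C \<in> components ?X" for C
  proof -
    have C: "connected C" "C \<subseteq> ?X"
      using that in_components_connected in_components_subset by blast+
    then have "C = fst ` C \<times> {0}"
      by force
    moreover have "connected (fst ` C)" "fst ` C \<subseteq> julia base_poly"
      using C by (auto intro!: connected_continuous_image continuous_intros)
    ultimately have "acc_set skew C = (if 1 \<in> fst ` C then {(1, 0)} else {})"
      using acc_set_julia[of "fst ` C"] by simp
    moreover have "1 \<in> fst ` C \<longleftrightarrow> (1, 0) \<in> C"
      using C(2) by force
    ultimately show ?thesis
      by simp
  qed
  have "(1, 0) \<in> \<Union>(components ?X)"
    using one_in_julia unfolding Union_components by simp
  then obtain C where C: "C \<in> components ?X" "(1, 0) \<in> C"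
    by blast
  have "(\<Union>C\<in>components ?X. acc_set skew C) = {(1, 0)}"
  proof (intro equalityI UN_least)
    show "acc_set skew D \<subseteq> {(1, 0)}" if "D \<in> components ?X" for D
      using *[OF that] by simp
    show "{(1, 0)} \<subseteq> (\<Union>C\<in>components ?X. acc_set skew C)"
      using *[OF C(1)] C by auto
  qed
  then show ?thesis
    by (simp add: acc_cc_def)
qed

text \<open>\<open>t\<close> is pulled back \<open>n\<close> times by the inverse branch at 1, which
  stays in the Julia set.\<close>

lemma julia_backward_orbit:
  assumes t: "t \<in> julia base_poly"
  shows "\<exists>z\<in>julia base_poly. (base_map ^^ n) z = t \<and> (\<forall>j<n. norm ((base_map ^^ j) z - 1) \<le> 1/100)"
proof (induction n)
  case 0
  then show ?case using t by auto
next
  case (Suc n)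
  then obtain z where z: "z \<in> julia base_poly" "(base_map ^^ n) z = t"
    "\<And>j. j < n \<Longrightarrow> norm ((base_map ^^ j) z - 1) \<le> 1/100"
    by blast
  have "norm z \<le> 101/100"
    using z(1) filled_julia_norm by (auto simp: julia_eq)
  then have "norm (z - 1) \<le> 7"
    using norm_triangle_ineq4[of z 1] by simp
  then obtain y where y: "y \<in> cball 1 (1/100)" "base_map y = z"
    using base_map_branch_at_1(1) by blast
  then have y1: "norm (y - 1) \<le> 1/100"
    by (simp add: dist_norm norm_minus_commute)
  have shift: "(base_map ^^ Suc j) y = (base_map ^^ j) z" for j
    using y(2) by (simp add: funpow_swap1)
  have "norm ((base_map ^^ j) y - 1) \<le> 1/100" if "j < Suc n" for j
    using that y1 z(3) shift by (cases j) (auto simp del: funpow.simps(2))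
  moreover have "y \<in> julia base_poly"
    using julia_branch_at_1[of y] y(2) y1 z(1) by simp
  ultimately show ?case
    using shift[of n] z(2) by blast
qed

text \<open>Critical points over suitable \<open>z n\<close> spend \<open>n\<close> steps near 1,
  which keeps their fibre coordinate bounded, and then land over one fixed \<open>t\<close> near 0.
  A convergent subsequence gives an accumulation point over \<open>t\<close>, different from the
  saddle.\<close>

lemma acc_set_skew_neq: "acc_set skew (julia base_poly \<times> {0}) \<noteq> {(1, 0)}"
proof -
  obtain t where t: "t \<in> julia base_poly" "norm t \<le> 13/100"
    using julia_near_0 by blast
  have "\<forall>n. \<exists>z. z \<in> julia base_poly \<and> (base_map ^^ n) z = t \<and>
      (\<forall>j<n. norm ((base_map ^^ j) z - 1) \<le> 1/100)"
    using julia_backward_orbit[OF t(1)] by blast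
  from choice[OF this] obtain z where "\<forall>n. z n \<in> julia base_poly \<and> (base_map ^^ n) (z n) = t \<and>
      (\<forall>j<n. norm ((base_map ^^ j) (z n) - 1) \<le> 1/100)" ..
  then have z: "z n \<in> julia base_poly" "(base_map ^^ n) (z n) = t"
    "j < n \<Longrightarrow> norm ((base_map ^^ j) (z n) - 1) \<le> 1/100" for n j
    by simp_all
  define w where "w n = snd ((skew ^^ n) (z n, 0))" for n
  have it: "(skew ^^ n) (z n, 0) = (t, w n)" for n
    using z(2)[of n] by (simp add: prod_eq_iff w_def fst_skew_iterate)
  have "w n \<in> cball 0 (9/10)" for n
    using attracted_while_near_1[of "(z n, 0)" n] z(3) by (simp add: w_def)
  then have "\<forall>n. w n \<in> cball 0 (9/10)"
    by blast
  from seq_compactE[OF compact_imp_seq_compact[OF compact_cball] this]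
  obtain l r where l: "strict_mono r" "(w \<circ> r) \<longlonglongrightarrow> l" .
  have "(t, l) \<in> closure (\<Union>n\<in>{N..}. (skew ^^ n) ` (julia base_poly \<times> {0}))" for N
  proof -
    \<comment> \<open>The shift by \<open>N\<close> makes every iterate index
      \<open>r (k + N)\<close> at least \<open>N\<close>, as the tail union demands.\<close>
    have lim: "(\<lambda>k. (t, (w \<circ> r) (k + N))) \<longlonglongrightarrow> (t, l)"
      by (intro tendsto_Pair tendsto_const LIMSEQ_ignore_initial_segment l)
    have mem: "(t, (w \<circ> r) (k + N)) \<in> (\<Union>n\<in>{N..}. (skew ^^ n) ` (julia base_poly \<times> {0}))" for k
    proof -
      have "r (k + N) \<ge> N"
        using seq_suble[OF l(1), of "k + N"] by simp
      moreover have "(t, w (r (k + N))) \<in> (skew ^^ r (k + N)) ` (julia base_poly \<times> {0})"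
        using imageI[of "(z (r (k + N)), 0)" "julia base_poly \<times> {0}" "skew ^^ r (k + N)"]
        unfolding it by (simp add: z(1))
      ultimately show ?thesis
        by (intro UN_I[of "r (k + N)"]) simp_all
    qed
    show ?thesis
      unfolding closure_sequential by (rule exI, rule conjI[OF allI[OF mem] lim])
  qed
  then have "(t, l) \<in> acc_set skew (julia base_poly \<times> {0})"
    by (simp add: acc_set_def)
  moreover have "(t, l) \<notin> {(1, 0)}"
    using t(2) by auto
  ultimately show ?thesis
    by metis
qed


section \<open>Extension to the projective plane\<close>

text \<open>The homogeneous lift of degree four of \<open>skew\<close>, with the third coordinate as
  homogenising variable.\<close>

definition proj_lift :: "complex ^ 3 \<Rightarrow> complex ^ 3" where
  "proj_lift v = (\<chi> k. if k = 1 then v $ 1 ^ 3 * (1001 * v $ 3 - 1000 * v $ 1)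
     else if k = 2 then v $ 2 ^ 4 + (4 * (v $ 1)\<^sup>2 * (v $ 3)\<^sup>2 - 4 * v $ 3 ^ 4)
     else v $ 3 ^ 4)"

definition affine_coords :: "3 \<Rightarrow> complex \<times> complex \<Rightarrow> complex ^ 3" where
  "affine_coords i a = (\<chi> k. if k = i then 1 else if k = i + 1 then fst a else snd a)"

lemma affine_point_eq: "affine_point i a = abs_proj_plane (affine_coords i a)"
  by (simp add: affine_point_def affine_coords_def)

lemma affine_coords_nonzero: "affine_coords i a \<noteq> 0"
proof
  assume "affine_coords i a = 0"
  then have "affine_coords i a $ i = 0"
    by simp
  then show False
    by (simp add: affine_coords_def)
qed

lemma proj_lift_scale: "proj_lift (c *s v) = c ^ 4 *s proj_lift v"
  by (simp add: proj_lift_def vec_eq_iff algebra_simps eval_nat_numeral)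

text \<open>There is no point of indeterminacy: on the line at infinity \<open>v $ 3 = 0\<close> the
  first two coordinates reduce to nonzero multiples of \<open>v $ 1 ^ 4\<close> and
  \<open>v $ 2 ^ 4\<close>.\<close>

lemma proj_lift_nonzero:
  assumes "v \<noteq> 0"
  shows "proj_lift v \<noteq> 0"
proof
  assume "proj_lift v = 0"
  then have *: "proj_lift v $ k = 0" for k
    by simp
  have 3: "v $ 3 = 0"
    using *[of 3] by (simp add: proj_lift_def)
  have "v $ 1 = 0"
    using *[of 1] 3 by (auto simp: proj_lift_def)
  moreover have "v $ 2 = 0"
    using *[of 2] 3 by (auto simp: proj_lift_def)
  ultimately show False
    using assms 3 by (simp add: vec_eq_iff forall_3)
qed

lemma rep_abs_proj_plane:
  assumes "v \<noteq> 0"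
  obtains c where "c \<noteq> 0" "rep_proj_plane (abs_proj_plane v) = c *s v"
proof -
  have "proj_rel v v"
    using assms unfolding proj_rel_def by (intro conjI exI[of _ 1]) auto
  from rep_abs_rsp[OF Quotient3_proj_plane this] that show ?thesis
    by (auto simp: proj_rel_def)
qed

lemma abs_proj_plane_scale:
  assumes "v \<noteq> 0" "c \<noteq> 0"
  shows "abs_proj_plane (c *s v) = abs_proj_plane v"
proof -
  have "proj_rel v (c *s v)"
    using assms by (auto simp: proj_rel_def)
  from Quotient3_rel_abs[OF Quotient3_proj_plane this] show ?thesis
    by simp
qed

definition proj_map :: "proj_plane \<Rightarrow> proj_plane" where
  "proj_map P = abs_proj_plane (proj_lift (rep_proj_plane P))"

text \<open>The chosen representative differs from \<open>v\<close> by a nonzero scalar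
  \<open>c\<close>, which the lift turns into \<open>c ^ 4\<close>.\<close>

lemma proj_map_abs:
  assumes "v \<noteq> 0"
  shows "proj_map (abs_proj_plane v) = abs_proj_plane (proj_lift v)"
proof -
  obtain c where "c \<noteq> 0" "rep_proj_plane (abs_proj_plane v) = c *s v"
    using rep_abs_proj_plane[OF assms] .
  then show ?thesis
    using abs_proj_plane_scale[OF proj_lift_nonzero[OF assms], of "c ^ 4"]
    by (simp add: proj_map_def proj_lift_scale)
qed

lemma abs_in_affine_domain:
  assumes "v \<noteq> 0"
  shows "abs_proj_plane v \<in> affine_domain i \<longleftrightarrow> v $ i \<noteq> 0"
proof -
  obtain c where "c \<noteq> 0" "rep_proj_plane (abs_proj_plane v) = c *s v"
    using rep_abs_proj_plane[OF assms] .
  then show ?thesis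
    by (simp add: affine_domain_def)
qed

lemma affine_chart_abs:
  assumes "v \<noteq> 0"
  shows "affine_chart i (abs_proj_plane v) = (v $ (i + 1) / v $ i, v $ (i + 2) / v $ i)"
proof -
  obtain c where "c \<noteq> 0" "rep_proj_plane (abs_proj_plane v) = c *s v"
    using rep_abs_proj_plane[OF assms] .
  then show ?thesis
    by (simp add: affine_chart_def)
qed

text \<open>A pointwise, scalar-valued form of \<open>holomorphic2_on\<close>; it is closed under
  arithmetic, so chart expressions can be handled one coordinate at a time.\<close>

definition holomorphic2_at :: "(complex \<times> complex \<Rightarrow> complex) \<Rightarrow> complex \<times> complex \<Rightarrow> bool" where
  "holomorphic2_at g x \<longleftrightarrow>
     (\<exists>D. (g has_derivative D) (at x) \<and> (\<forall>c v. D (scaleC2 c v) = c * D v))"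

lemma holomorphic2_at_const: "holomorphic2_at (\<lambda>_. b) x"
  unfolding holomorphic2_at_def by (intro exI[of _ "\<lambda>_. 0"]) auto

lemma holomorphic2_at_fst: "holomorphic2_at fst x"
  unfolding holomorphic2_at_def
  by (intro exI[of _ fst]) (auto simp: scaleC2_def intro!: derivative_eq_intros)

lemma holomorphic2_at_snd: "holomorphic2_at snd x"
  unfolding holomorphic2_at_def
  by (intro exI[of _ snd]) (auto simp: scaleC2_def intro!: derivative_eq_intros)

lemma holomorphic2_at_add:
  assumes "holomorphic2_at f x" "holomorphic2_at g x"
  shows "holomorphic2_at (\<lambda>a. f a + g a) x"
proof -
  obtain D E where "(f has_derivative D) (at x)" "\<And>c v. D (scaleC2 c v) = c * D v"
    "(g has_derivative E) (at x)" "\<And>c v. E (scaleC2 c v) = c * E v"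
    using assms unfolding holomorphic2_at_def by blast
  then show ?thesis
    unfolding holomorphic2_at_def
    by (intro exI[of _ "\<lambda>h. D h + E h"] conjI has_derivative_add) (auto simp: algebra_simps)
qed

lemma holomorphic2_at_diff:
  assumes "holomorphic2_at f x" "holomorphic2_at g x"
  shows "holomorphic2_at (\<lambda>a. f a - g a) x"
proof -
  obtain D E where "(f has_derivative D) (at x)" "\<And>c v. D (scaleC2 c v) = c * D v"
    "(g has_derivative E) (at x)" "\<And>c v. E (scaleC2 c v) = c * E v"
    using assms unfolding holomorphic2_at_def by blast
  then show ?thesis
    unfolding holomorphic2_at_def
    by (intro exI[of _ "\<lambda>h. D h - E h"] conjI has_derivative_diff) (auto simp: algebra_simps)
qed

lemma holomorphic2_at_mult:
  assumes "holomorphic2_at f x" "holomorphic2_at g x"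
  shows "holomorphic2_at (\<lambda>a. f a * g a) x"
proof -
  obtain D E where "(f has_derivative D) (at x)" "\<And>c v. D (scaleC2 c v) = c * D v"
    "(g has_derivative E) (at x)" "\<And>c v. E (scaleC2 c v) = c * E v"
    using assms unfolding holomorphic2_at_def by blast
  then show ?thesis
    unfolding holomorphic2_at_def
    by (intro exI[of _ "\<lambda>h. f x * E h + D h * g x"] conjI has_derivative_mult) (auto simp: algebra_simps)
qed

lemma holomorphic2_at_power: "holomorphic2_at f x \<Longrightarrow> holomorphic2_at (\<lambda>a. f a ^ n) x"
  by (induction n) (auto intro: holomorphic2_at_const holomorphic2_at_mult)

lemma holomorphic2_at_divide:
  assumes "holomorphic2_at f x" "holomorphic2_at g x" "g x \<noteq> 0"
  shows "holomorphic2_at (\<lambda>a. f a / g a) x"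
proof -
  obtain D E where "(f has_derivative D) (at x)" "\<And>c v. D (scaleC2 c v) = c * D v"
    "(g has_derivative E) (at x)" "\<And>c v. E (scaleC2 c v) = c * E v"
    using assms unfolding holomorphic2_at_def by blast
  then show ?thesis
    unfolding holomorphic2_at_def
    by (intro exI[of _ "\<lambda>h. - f x * (inverse (g x) * E h * inverse (g x)) + D h / g x"] conjI
        has_derivative_divide assms(3)) (auto simp: algebra_simps)
qed

lemma holomorphic2_on_Pair:
  assumes "\<And>x. x \<in> S \<Longrightarrow> holomorphic2_at f x" "\<And>x. x \<in> S \<Longrightarrow> holomorphic2_at g x"
  shows "holomorphic2_on (\<lambda>a. (f a, g a)) S"
  unfolding holomorphic2_on_def
proof
  fix x assume "x \<in> S"
  then obtain D E where "(f has_derivative D) (at x)" "\<And>c v. D (scaleC2 c v) = c * D v"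
    "(g has_derivative E) (at x)" "\<And>c v. E (scaleC2 c v) = c * E v"
    using assms unfolding holomorphic2_at_def by meson
  then show "\<exists>D. ((\<lambda>a. (f a, g a)) has_derivative D) (at x) \<and> (\<forall>c v. D (scaleC2 c v) = scaleC2 c (D v))"
    by (intro exI[of _ "\<lambda>h. (D h, E h)"] conjI has_derivative_Pair) (auto simp: scaleC2_def)
qed

lemma holomorphic2_at_affine_coords: "holomorphic2_at (\<lambda>a. affine_coords i a $ k) x"
  by (cases "k = i"; cases "k = i + 1")
    (simp_all add: affine_coords_def holomorphic2_at_const holomorphic2_at_fst holomorphic2_at_snd)

lemma holomorphic2_at_proj_lift: "holomorphic2_at (\<lambda>a. proj_lift (affine_coords i a) $ k) x"
proof -
  note intros = holomorphic2_at_affine_coords holomorphic2_at_const holomorphic2_at_add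
    holomorphic2_at_diff holomorphic2_at_mult holomorphic2_at_power
  show ?thesis
    by (cases "k = 1"; cases "k = 2") (simp_all add: proj_lift_def, (intro intros)+)
qed

text \<open>In charts the map is a pair of quotients of coordinates of the lift, defined exactly
  where the common denominator does not vanish.\<close>

lemma holomorphic_self_map_proj_map: "holomorphic_self_map proj_map"
  unfolding holomorphic_self_map_def
proof (intro allI conjI)
  fix i j :: 3
  define L where "L k a = proj_lift (affine_coords i a) $ k" for k a
  have G: "proj_map (affine_point i a) = abs_proj_plane (proj_lift (affine_coords i a))" for a
    unfolding affine_point_eq by (rule proj_map_abs[OF affine_coords_nonzero])
  have dom: "{a. proj_map (affine_point i a) \<in> affine_domain j} = {a. L j a \<noteq> 0}"
    unfolding G L_def by (simp add: abs_in_affine_domain proj_lift_nonzero affine_coords_nonzero)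
  have hol: "holomorphic2_at (L k) x" for k x
    unfolding L_def by (rule holomorphic2_at_proj_lift)
  then have "continuous_on UNIV (L j)"
    unfolding holomorphic2_at_def
    by (meson continuous_at_imp_continuous_on has_derivative_continuous)
  then show "open {a. proj_map (affine_point i a) \<in> affine_domain j}"
    unfolding dom by (intro open_Collect_neq continuous_on_const)
  have "(\<lambda>a. affine_chart j (proj_map (affine_point i a))) =
      (\<lambda>a. (L (j + 1) a / L j a, L (j + 2) a / L j a))"
    unfolding G L_def by (simp add: affine_chart_abs proj_lift_nonzero affine_coords_nonzero)
  then show "holomorphic2_on (\<lambda>a. affine_chart j (proj_map (affine_point i a)))
      {a. proj_map (affine_point i a) \<in> affine_domain j}"
    unfolding dom by (auto intro!: holomorphic2_on_Pair holomorphic2_at_divide hol)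
qed

lemma regular_map_skew: "regular_map skew"
  unfolding regular_map_def
proof (intro exI[of _ proj_map] conjI allI holomorphic_self_map_proj_map)
  fix x
  have "proj_lift (affine_coords 3 x) = affine_coords 3 (skew x)"
    by (simp add: vec_eq_iff forall_3 proj_lift_def affine_coords_def skew_def base_map_def)
  then show "proj_map (affine_point 3 x) = affine_point 3 (skew x)"
    using proj_map_abs[OF affine_coords_nonzero] by (simp add: affine_point_eq)
qed


theorem theorem1p6:
  shows "\<exists>(p :: complex poly) (q :: complex poly poly).
    polynomial_skew_product 4 p q \<and>
    regular_map (skew_map p q) \<and>
    axiom_A (skew_map p q) \<and>
    \<not> connected (julia p) \<and> \<not> totally_disconnected (julia p) \<and>
    acc_pt (skew_map p q) (crit_set p q) = acc_cc (skew_map p q) (crit_set p q) \<and>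
    acc_cc (skew_map p q) (crit_set p q) \<noteq> acc_set (skew_map p q) (crit_set p q)"
proof (intro exI conjI)
  show "polynomial_skew_product 4 base_poly fiber_family"
    by (rule polynomial_skew_product_skew)
qed (simp_all add: skew_map_eq crit_set_eq regular_map_skew axiom_A_skew not_connected_julia
    not_totally_disconnected_julia acc_pt_skew acc_cc_skew acc_set_skew_neq[symmetric])

end
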